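(* Let $G$ be a finite simple graph and let \[ Y_G=\sum_{\alpha}X_G^\alpha, \] where the sum ranges over all maps $\alpha:V(G)\to\mathbb{N}$. Then the following conditions are equivalent: (1) $[s_\lambda]Y_G\ge 0$ for all partitions $\lambda$ with $\ell(\lambda)\le 2$. (2) $[s_{(k,k)}]Y_G\ge 0$ for all $k\ge 1$. (3) The independence polynomial $I_G(t)$ is log-concave. (4) The independence polynomial $I_G(t)$ is strongly log-concave.
   Context: $\mathbb{N}=\{0,1,2,\ldots\}$ and $\mathbf{x}=\{x_1,x_2,\ldots\}$ is a set of indeterminates. For $\alpha:V(G)\to\mathbb{N}$, a multicoloring of $G$ of type $\alpha$ is a map $\kappa$ assigning to each vertex $v$ a finite set $\kappa(v)$ of positive integers with $|\kappa(v)|=\alpha(v)$; it is proper if $\kappa(u)\cap\kappa(v)=\emptyset$ for every edge $uv$. Define $X_G^\alpha=\sum_\kappa x_1^{a_1}x_2^{a_2}\cdots$, summed over all proper multicolorings $\kappa$ of type $\alpha$, where $a_i$ is the number of vertices $v$ with $i\in\kappa(v)$. The series $Y_G$ is a symmetric formal power series whose homogeneous components are symmetric functions; $[s_\lambda]Y_G$ denotes the coefficient of the Schur function $s_\lambda$ in the Schur expansion of the component of degree $|\lambda|$. The length $\ell(\lambda)$ is the number of parts of $\lambda$. The independence polynomial is $I_G(t)=\sum_{j=0}^{\alpha(G)} i_jt^j$, where $i_j$ is the number of independent sets of $G$ of cardinality $j$ ($i_0=1$) and $\alpha(G)$ is the maximum size of an independent set. A polynomial $a_0+\cdots+a_dt^d$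 is log-concave if $a_j^2\ge a_{j-1}a_{j+1}$ for all $1\le j\le d-1$, and strongly log-concave if $a_ma_n\ge a_pa_q$ for all integers $0\le p<m\le n<q\le d$ with $m+n=p+q$. *)

theory Defs
  imports
    "HOL-Library.Multiset"
    "HOL-Library.FuncSet"
    "HOL-Computational_Algebra.Polynomial"
    "Graph_Theory.Digraph"
begin

text \<open>
  A finite simple graph is a digraph satisfying the locale predicate \<open>graph\<close> (finite, symmetric,
  loop-free, no parallel arcs): the edge \<open>uv\<close> is represented by the two arcs joining \<open>u\<close> and \<open>v\<close>.

  A formal power series in \<open>x\<^sub>1, x\<^sub>2, \<dots>\<close> with integer coefficients is the function that assigns to each
  monomial its coefficient. The multiset \<open>m\<close> stands for the monomial in which \<open>x\<^sub>i\<close> has the exponent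
  \<open>count m i\<close>, so the degree of \<open>m\<close> is \<open>size m\<close>. There is no variable \<open>x\<^sub>0\<close>: the series below have
  coefficient 0 at every multiset that contains 0.
\<close>

type_synonym power_series = "nat multiset \<Rightarrow> int"

definition homogeneous_component :: "nat \<Rightarrow> power_series \<Rightarrow> power_series" where
  "homogeneous_component n f = (\<lambda>m. if size m = n then f m else 0)"


section \<open>Multicolorings\<close>

definition multicolorings ::
    "('a, 'b) pre_digraph \<Rightarrow> ('a \<Rightarrow> nat) \<Rightarrow> ('a \<Rightarrow> nat set) set" where
  "multicolorings G \<alpha> = {\<kappa> \<in> verts G \<rightarrow>\<^sub>E {S. finite S \<and> S \<subseteq> {1..}}. \<forall>v \<in> verts G. card (\<kappa> v) = \<alpha> v}"

definition proper_multicolorings ::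
    "('a, 'b) pre_digraph \<Rightarrow> ('a \<Rightarrow> nat) \<Rightarrow> ('a \<Rightarrow> nat set) set" where
  "proper_multicolorings G \<alpha> =
     {\<kappa> \<in> multicolorings G \<alpha>. \<forall>u v. u \<rightarrow>\<^bsub>G\<^esub> v \<longrightarrow> \<kappa> u \<inter> \<kappa> v = {}}"

definition X_series :: "('a, 'b) pre_digraph \<Rightarrow> ('a \<Rightarrow> nat) \<Rightarrow> power_series" where
  "X_series G \<alpha> = (\<lambda>m. int (card
     {\<kappa> \<in> proper_multicolorings G \<alpha>. \<forall>i. count m i = card {v \<in> verts G. i \<in> \<kappa> v}}))"

text \<open>
  The sum of the series over all \<open>\<alpha> : V(G) \<rightarrow> \<nat>\<close> is taken coefficientwise. Since \<^const>\<open>sum\<close> vanishes on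
  infinite sets, it is restricted to the \<open>\<alpha>\<close> that contribute to the coefficient of \<open>m\<close>; there are
  finitely many of them by \<open>finite_X_series_support\<close>.
\<close>

definition Y_series :: "('a, 'b) pre_digraph \<Rightarrow> power_series" where
  "Y_series G = (\<lambda>m. \<Sum>\<alpha> \<in> {\<alpha> \<in> verts G \<rightarrow>\<^sub>E UNIV. X_series G \<alpha> m \<noteq> 0}. X_series G \<alpha> m)"

lemma multicolor_subset:
  assumes "finite (verts G)" "\<forall>i. count m i = card {v \<in> verts G. i \<in> \<kappa> v}" "v \<in> verts G"
  shows "\<kappa> v \<subseteq> set_mset m"
proof
  fix i assume "i \<in> \<kappa> v"
  then have "{v \<in> verts G. i \<in> \<kappa> v} \<noteq> {}"
    using assms(3) by blast
  then have "count m i \<noteq> 0"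
    using assms(1,2) by simp
  then show "i \<in> set_mset m"
    by (simp add: not_in_iff)
qed

lemma finite_proper_multicolorings_of_content:
  assumes "finite (verts G)"
  shows "finite {\<kappa> \<in> proper_multicolorings G \<alpha>. \<forall>i. count m i = card {v \<in> verts G. i \<in> \<kappa> v}}"
proof (rule finite_subset)
  show "{\<kappa> \<in> proper_multicolorings G \<alpha>. \<forall>i. count m i = card {v \<in> verts G. i \<in> \<kappa> v}}
      \<subseteq> verts G \<rightarrow>\<^sub>E Pow (set_mset m)"
  proof
    fix \<kappa> assume k: "\<kappa> \<in> {\<kappa> \<in> proper_multicolorings G \<alpha>.
      \<forall>i. count m i = card {v \<in> verts G. i \<in> \<kappa> v}}"
    then have "\<forall>i. count m i = card {v \<in> verts G. i \<in> \<kappa> v}"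
      by blast
    from multicolor_subset[OF assms this] k show "\<kappa> \<in> verts G \<rightarrow>\<^sub>E Pow (set_mset m)"
      unfolding proper_multicolorings_def multicolorings_def PiE_iff by blast
  qed
  show "finite (verts G \<rightarrow>\<^sub>E Pow (set_mset m))"
    using assms by (intro finite_PiE) auto
qed

lemma finite_X_series_support:
  assumes "finite (verts G)"
  shows "finite {\<alpha> \<in> verts G \<rightarrow>\<^sub>E UNIV. X_series G \<alpha> m \<noteq> 0}"
proof (rule finite_subset)
  show "{\<alpha> \<in> verts G \<rightarrow>\<^sub>E UNIV. X_series G \<alpha> m \<noteq> 0} \<subseteq> verts G \<rightarrow>\<^sub>E {..card (set_mset m)}"
  proof
    fix \<alpha> assume a: "\<alpha> \<in> {\<alpha> \<in> verts G \<rightarrow>\<^sub>E UNIV. X_series G \<alpha> m \<noteq> 0}"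
    then have "card {\<kappa> \<in> proper_multicolorings G \<alpha>.
        \<forall>i. count m i = card {v \<in> verts G. i \<in> \<kappa> v}} \<noteq> 0"
      unfolding X_series_def mem_Collect_eq of_nat_eq_0_iff by (rule conjunct2)
    then have "{\<kappa> \<in> proper_multicolorings G \<alpha>.
        \<forall>i. count m i = card {v \<in> verts G. i \<in> \<kappa> v}} \<noteq> {}"
      by (rule contrapos_nn) (simp only: card.empty)
    then obtain \<kappa> where k: "\<kappa> \<in> multicolorings G \<alpha>"
        "\<forall>i. count m i = card {v \<in> verts G. i \<in> \<kappa> v}"
      unfolding proper_multicolorings_def by blast
    have "\<alpha> v \<le> card (set_mset m)" if "v \<in> verts G" for v
      using card_mono[OF finite_set_mset multicolor_subset[OF assms k(2) that]] k(1) that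
      unfolding multicolorings_def by fastforce
    then show "\<alpha> \<in> verts G \<rightarrow>\<^sub>E {..card (set_mset m)}"
      using a unfolding PiE_iff by blast
  qed
  show "finite (verts G \<rightarrow>\<^sub>E {..card (set_mset m)})"
    using assms by (intro finite_PiE) auto
qed


section \<open>Schur functions\<close>

definition is_partition :: "nat list \<Rightarrow> bool" where
  "is_partition \<mu> \<longleftrightarrow> sorted_wrt (\<ge>) \<mu> \<and> 0 \<notin> set \<mu>"

definition partitions :: "nat \<Rightarrow> nat list set" where
  "partitions n = {\<mu>. is_partition \<mu> \<and> sum_list \<mu> = n}"

definition diagram :: "nat list \<Rightarrow> (nat \<times> nat) set" where
  "diagram \<mu> = {(i, j). i < length \<mu> \<and> j < \<mu> ! i}"

definition semistandard_tableaux :: "nat list \<Rightarrow> (nat \<times> nat \<Rightarrow> nat) set" where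
  "semistandard_tableaux \<mu> = {T \<in> diagram \<mu> \<rightarrow>\<^sub>E {1..}.
     (\<forall>i j j'. (i, j) \<in> diagram \<mu> \<and> (i, j') \<in> diagram \<mu> \<and> j < j' \<longrightarrow> T (i, j) \<le> T (i, j')) \<and>
     (\<forall>i i' j. (i, j) \<in> diagram \<mu> \<and> (i', j) \<in> diagram \<mu> \<and> i < i' \<longrightarrow> T (i, j) < T (i', j))}"

definition schur :: "nat list \<Rightarrow> power_series" where
  "schur \<mu> = (\<lambda>m. int (card
     {T \<in> semistandard_tableaux \<mu>. \<forall>i. count m i = card {c \<in> diagram \<mu>. T c = i}}))"

text \<open>
  The coefficient of \<open>s\<^sub>\<mu>\<close> in the Schur expansion of the component of degree \<open>|\<mu>|\<close>. The description is
  proper when that component is a symmetric function, since the Schur functions \<open>s\<^sub>\<nu>\<close> with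
  \<open>|\<nu>| = n\<close> are a basis of the symmetric functions of degree \<open>n\<close> over the integers.
\<close>

definition schur_coeff :: "nat list \<Rightarrow> power_series \<Rightarrow> int" where
  "schur_coeff \<mu> f = (THE a. \<exists>c. c \<mu> = a \<and>
     homogeneous_component (sum_list \<mu>) f = (\<lambda>m. \<Sum>\<nu> \<in> partitions (sum_list \<mu>). c \<nu> * schur \<nu> m))"

lemma finite_partitions: "finite (partitions n)"
proof (rule finite_subset)
  have "length \<mu> \<le> sum_list \<mu>" if "0 \<notin> set \<mu>" for \<mu> :: "nat list"
    using that by (induction \<mu>) (auto simp: Suc_le_eq add_less_le_mono)
  then show "partitions n \<subseteq> {\<mu>. set \<mu> \<subseteq> {..n} \<and> length \<mu> \<le> n}"
    by (auto simp: partitions_def is_partition_def member_le_sum_list)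
  show "finite {\<mu>. set \<mu> \<subseteq> {..n} \<and> length \<mu> \<le> n}"
    by (rule finite_lists_length_le) simp
qed

lemma finite_diagram: "finite (diagram \<mu>)"
proof -
  have "diagram \<mu> = (SIGMA i : {..<length \<mu>}. {..<\<mu> ! i})"
    by (auto simp: diagram_def)
  then show ?thesis
    by simp
qed

lemma finite_semistandard_tableaux_of_content:
  "finite {T \<in> semistandard_tableaux \<mu>. \<forall>i. count m i = card {c \<in> diagram \<mu>. T c = i}}"
proof (rule finite_subset)
  show "{T \<in> semistandard_tableaux \<mu>. \<forall>i. count m i = card {c \<in> diagram \<mu>. T c = i}}
      \<subseteq> diagram \<mu> \<rightarrow>\<^sub>E set_mset m"
  proof
    fix T assume t: "T \<in> {T \<in> semistandard_tableaux \<mu>.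
      \<forall>i. count m i = card {c \<in> diagram \<mu>. T c = i}}"
    have "T c \<in> set_mset m" if "c \<in> diagram \<mu>" for c
    proof -
      have "c \<in> {d \<in> diagram \<mu>. T d = T c}"
        using that by blast
      moreover have "finite {d \<in> diagram \<mu>. T d = T c}"
        by (rule finite_subset[OF _ finite_diagram[of \<mu>]]) blast
      ultimately have "card {d \<in> diagram \<mu>. T d = T c} \<noteq> 0"
        using card_0_eq by blast
      moreover have "count m (T c) = card {d \<in> diagram \<mu>. T d = T c}"
        using t by blast
      ultimately show ?thesis
        by (metis not_in_iff)
    qed
    then show "T \<in> diagram \<mu> \<rightarrow>\<^sub>E set_mset m"
      using t unfolding semistandard_tableaux_def PiE_iff by blast
  qed
  show "finite (diagram \<mu> \<rightarrow>\<^sub>E set_mset m)"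
    by (intro finite_PiE finite_diagram) auto
qed


section \<open>Independence polynomials and log-concavity\<close>

definition independent_sets :: "('a, 'b) pre_digraph \<Rightarrow> 'a set set" where
  "independent_sets G = {S. S \<subseteq> verts G \<and> (\<forall>u \<in> S. \<forall>v \<in> S. \<not> u \<rightarrow>\<^bsub>G\<^esub> v)}"

definition independence_number :: "('a, 'b) pre_digraph \<Rightarrow> nat" where
  "independence_number G = Max (card ` independent_sets G)"

definition independence_poly :: "('a, 'b) pre_digraph \<Rightarrow> int poly" where
  "independence_poly G =
     (\<Sum>j = 0..independence_number G. monom (int (card {S \<in> independent_sets G. card S = j})) j)"

definition log_concave :: "int poly \<Rightarrow> bool" where
  "log_concave p \<longleftrightarrow>
     (\<forall>j. 1 \<le> j \<and> j \<le> degree p - 1 \<longrightarrow> (coeff p j)\<^sup>2 \<ge> coeff p (j - 1) * coeff p (j + 1))"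

definition strongly_log_concave :: "int poly \<Rightarrow> bool" where
  "strongly_log_concave p \<longleftrightarrow>
     (\<forall>k m n q. k < m \<and> m \<le> n \<and> n < q \<and> q \<le> degree p \<and> m + n = k + q \<longrightarrow>
        coeff p m * coeff p n \<ge> coeff p k * coeff p q)"

end

theory Submission
  imports Defs "HOL-Combinatorics.Transposition"
begin

text \<open>
  Choosing a proper multicoloring means choosing, independently for each colour, an independent set,
  so \<open>Y\<^sub>G = \<Prod>\<^sub>i I\<^sub>G(x\<^sub>i)\<close>. A Schur function with more than two rows vanishes in two variables, while
  \<open>s\<^sub>\<nu>(x\<^sub>1, x\<^sub>2)\<close> has coefficient 1 at \<open>x\<^sub>1\<^sup>p x\<^sub>2\<^sup>q\<close> if \<open>\<nu>\<^sub>2 \<le> min p q\<close> and 0 otherwise. Hence the coefficient of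
  \<open>s\<close> with index \<open>(a, b)\<close> in \<open>Y\<^sub>G\<close> is \<open>i\<^sub>a i\<^sub>b - i\<^sub>a\<^sub>+\<^sub>1 i\<^sub>b\<^sub>-\<^sub>1\<close>. These numbers are nonnegative for \<open>a = b\<close> iff
  \<open>I\<^sub>G\<close> is log-concave, and for all \<open>a \<ge> b\<close> if it is strongly log-concave. The two are equivalent since
  \<open>I\<^sub>G\<close> has no internal zeros.

  That the Schur coefficients are meaningful rests on the symmetry of Schur functions (the
  Bender-Knuth involution) and on the unitriangularity of the Kostka numbers for dominance order.
\<close>

section \<open>Tableaux as Gelfand-Tsetlin patterns\<close>

lemma sum_lessThan_eq_imp_eq:
  fixes f g :: "nat \<Rightarrow> nat"
  assumes "\<And>i. f i \<le> g i" "(\<Sum>i<n. f i) = (\<Sum>i<n. g i)" "i < n"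
  shows "f i = g i"
  using sum_mono_inv[of f "{..<n}" g i] assms by auto

text \<open>Padding with zeros lets partitions of different lengths be compared row by row, without
  side conditions on the index.\<close>

definition row :: "nat list \<Rightarrow> nat \<Rightarrow> nat" where
  "row \<mu> i = (if i < length \<mu> then \<mu> ! i else 0)"

lemma row_antimono:
  assumes "is_partition \<mu>" "i \<le> j"
  shows "row \<mu> j \<le> row \<mu> i"
  using assms by (cases "i = j") (auto simp: row_def is_partition_def sorted_wrt_iff_nth_less)

lemma row_eq_0_iff: "is_partition \<mu> \<Longrightarrow> row \<mu> i = 0 \<longleftrightarrow> length \<mu> \<le> i"
  by (auto simp: row_def is_partition_def in_set_conv_nth)

lemma partition_eqI:
  assumes "is_partition \<mu>" "is_partition \<nu>" "\<And>i. row \<mu> i = row \<nu> i"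
  shows "\<mu> = \<nu>"
proof -
  have "length \<mu> \<le> i \<longleftrightarrow> length \<nu> \<le> i" for i
    using assms row_eq_0_iff by metis
  then have "length \<mu> = length \<nu>"
    by (metis order_antisym order_refl)
  then show ?thesis
    using assms(3) unfolding row_def by (metis nth_equalityI)
qed

lemma sum_row: "(\<Sum>i<length \<mu>. row \<mu> i) = sum_list \<mu>"
  by (simp add: row_def sum_list_sum_nth lessThan_atLeast0)

lemma sum_row_ge: "length \<mu> \<le> n \<Longrightarrow> (\<Sum>i<n. row \<mu> i) = sum_list \<mu>"
  unfolding sum_row[symmetric] by (rule sum.mono_neutral_right) (auto simp: row_def)

lemma length_le_sum_list: "0 \<notin> set \<mu> \<Longrightarrow> length \<mu> \<le> sum_list (\<mu> :: nat list)"
  by (induction \<mu>) (auto simp: Suc_le_eq add_less_le_mono)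

section \<open>Exponents as increments of partial sums\<close>

definition cumulative :: "nat multiset \<Rightarrow> nat \<Rightarrow> nat" where
  "cumulative m k = (\<Sum>x\<le>k. count m x)"

lemma cumulative_mono: "k \<le> l \<Longrightarrow> cumulative m k \<le> cumulative m l"
  unfolding cumulative_def by (rule sum_mono2) auto

lemma cumulative_Suc: "cumulative m (Suc k) = cumulative m k + count m (Suc k)"
  by (simp add: cumulative_def)

lemma cumulative_eq_size:
  assumes "\<And>x. x \<in># m \<Longrightarrow> x \<le> k"
  shows "cumulative m k = size m"
  unfolding cumulative_def size_multiset_overloaded_eq
  by (rule sum.mono_neutral_right) (use assms in \<open>auto simp: not_in_iff\<close>)

lemma ex_cumulative_eq_size: "\<exists>k. cumulative m k = size m"
proof -
  have "x \<le> Max (set_mset m)" if "x \<in># m" for x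
    using that by simp
  then show ?thesis
    using cumulative_eq_size by blast
qed

text \<open>Differences of consecutive cumulative counts recover the counts of single letters. The
  cumulative form is the one that the levels of a pattern record.\<close>

lemma content_iff_cumulative:
  assumes "finite D"
  shows "(\<forall>i. count m i = card {c \<in> D. T c = i}) \<longleftrightarrow>
    (\<forall>k. cumulative m k = card {c \<in> D. T c \<le> k})"
    (is "?L \<longleftrightarrow> ?R")
proof -
  have split: "card {c \<in> D. T c \<le> Suc k} = card {c \<in> D. T c \<le> k} + card {c \<in> D. T c = Suc k}" for k
  proof -
    have "{c \<in> D. T c \<le> Suc k} = {c \<in> D. T c \<le> k} \<union> {c \<in> D. T c = Suc k}"
      by auto
    then show ?thesis
      using assms by (simp add: card_Un_disjoint disjoint_iff)
  qed
  show ?thesis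
  proof
    assume L: ?L
    show ?R
    proof
      fix k show "cumulative m k = card {c \<in> D. T c \<le> k}"
        by (induction k) (use L in \<open>simp_all add: cumulative_Suc split, simp add: cumulative_def\<close>)
    qed
  next
    assume R: ?R
    show ?L
    proof
      fix i show "count m i = card {c \<in> D. T c = i}"
      proof (cases i)
        case 0
        then show ?thesis using R[rule_format, of 0] by (simp add: cumulative_def)
      next
        case (Suc k)
        then show ?thesis using R[rule_format, of k] R[rule_format, of "Suc k"] split[of k]
          by (simp add: cumulative_Suc)
      qed
    qed
  qed
qed

text \<open>
  \<open>N i k\<close> is the number of entries \<open>\<le> k\<close> in row \<open>i\<close> of a tableau, and \<open>a k\<close> the number of entries \<open>\<le> k\<close> in
  the whole tableau. That level \<open>k\<close> has reached the shape \<open>\<mu>\<close> once \<open>a k = |\<mu>|\<close> follows from the bound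
  by \<open>row \<mu> i\<close>.
\<close>

definition gt_patterns :: "nat list \<Rightarrow> (nat \<Rightarrow> nat) \<Rightarrow> (nat \<Rightarrow> nat \<Rightarrow> nat) set" where
  "gt_patterns \<mu> a = {N. (\<forall>i. N i 0 = 0) \<and> (\<forall>i k. N i k \<le> N i (Suc k)) \<and>
     (\<forall>i k. N (Suc i) (Suc k) \<le> N i k) \<and> (\<forall>i k. N i k \<le> row \<mu> i) \<and>
     (\<forall>k. (\<Sum>i<length \<mu>. N i k) = a k)}"

lemma gt_patternsD:
  assumes "N \<in> gt_patterns \<mu> a"
  shows "N i 0 = 0" "N i k \<le> N i (Suc k)" "N (Suc i) (Suc k) \<le> N i k" "N i k \<le> row \<mu> i"
    "(\<Sum>i<length \<mu>. N i k) = a k"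
  using assms by (auto simp: gt_patterns_def)

lemma gt_pattern_mono_level:
  assumes "N \<in> gt_patterns \<mu> a" "k \<le> l"
  shows "N i k \<le> N i l"
  using gt_patternsD(2)[OF assms(1)] assms(2) by (rule lift_Suc_mono_le)

lemma gt_pattern_antimono_row:
  assumes "N \<in> gt_patterns \<mu> a" "i \<le> j"
  shows "N j k \<le> N i k"
proof -
  have "N (Suc i) k \<le> N i k" for i
    using gt_patternsD(2,3)[OF assms(1)] order_trans by metis
  then show ?thesis
    using assms(2) by (rule lift_Suc_antimono_le)
qed

lemma gt_pattern_column_strict:
  assumes "N \<in> gt_patterns \<mu> a" "i < j"
  shows "N j (Suc k) \<le> N i k"
  using gt_pattern_antimono_row[OF assms(1), of "Suc i" j "Suc k"] gt_patternsD(3)[OF assms(1), of i k] assms(2)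
  by simp

text \<open>In terms of tableaux: columns increase strictly and start at 1 or more, so row
  \<open>i\<close>, counted from 0, has no entry at most \<open>i\<close>.\<close>

lemma gt_pattern_eq_0: "N \<in> gt_patterns \<mu> a \<Longrightarrow> k \<le> i \<Longrightarrow> N i k = 0"
proof (induction k arbitrary: i)
  case 0
  then show ?case by (simp add: gt_patternsD)
next
  case (Suc k)
  then obtain j where j: "i = Suc j" by (cases i) auto
  then show ?case using gt_patternsD(3)[OF Suc.prems(1), of j k] Suc by auto
qed

lemma gt_pattern_full:
  assumes "N \<in> gt_patterns \<mu> a" "a k = sum_list \<mu>"
  shows "N i k = row \<mu> i"
proof (cases "i < length \<mu>")
  case True
  show ?thesis
    by (rule sum_lessThan_eq_imp_eq[OF _ _ True]) (use gt_patternsD[OF assms(1)] assms(2) in \<open>simp_all add: sum_row\<close>)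
next
  case False
  then show ?thesis using gt_patternsD(4)[OF assms(1), of i k] by (simp add: row_def)
qed

section \<open>The bijection between tableaux and patterns\<close>

definition row_counts :: "nat list \<Rightarrow> (nat \<times> nat \<Rightarrow> nat) \<Rightarrow> nat \<Rightarrow> nat \<Rightarrow> nat" where
  "row_counts \<mu> T i k = card {j. j < row \<mu> i \<and> T (i, j) \<le> k}"

lemma diagram_iff: "(i, j) \<in> diagram \<mu> \<longleftrightarrow> j < row \<mu> i"
  by (auto simp: diagram_def row_def)

lemma down_closed_eq_lessThan_card:
  fixes S :: "nat set"
  assumes "finite S" "\<And>i j. j \<in> S \<Longrightarrow> i < j \<Longrightarrow> i \<in> S"
  shows "S = {..<card S}"
proof (rule card_subset_eq[symmetric])
  show "{..<card S} \<subseteq> S"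
  proof
    fix x assume x: "x \<in> {..<card S}"
    show "x \<in> S"
    proof (rule ccontr)
      assume "x \<notin> S"
      then have "S \<subseteq> {..<x}"
        using assms(2) by (metis lessThan_iff linorder_neqE_nat subsetI)
      then have "card S \<le> x"
        using card_mono[of "{..<x}" S] by simp
      then show False using x by simp
    qed
  qed
qed (use assms in auto)

text \<open>Rows increase weakly, so the cells of a row with entry at most \<open>k\<close> form an
  initial segment, whose length is the row count.\<close>

lemma less_row_counts_iff:
  assumes "T \<in> semistandard_tableaux \<mu>"
  shows "j < row_counts \<mu> T i k \<longleftrightarrow> j < row \<mu> i \<and> T (i, j) \<le> k"
proof -
  have "j' < row \<mu> i \<and> T (i, j') \<le> k" if "j < row \<mu> i \<and> T (i, j) \<le> k" "j' < j" for j j'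
  proof -
    have "T (i, j') \<le> T (i, j)"
      using assms that unfolding semistandard_tableaux_def diagram_iff by auto
    then show ?thesis using that by auto
  qed
  then have "{j. j < row \<mu> i \<and> T (i, j) \<le> k} = {..<row_counts \<mu> T i k}"
    unfolding row_counts_def by (intro down_closed_eq_lessThan_card) auto
  then show ?thesis by blast
qed

lemma card_diagram_le:
  "card {c \<in> diagram \<mu>. T c \<le> k} = (\<Sum>i<length \<mu>. row_counts \<mu> T i k)"
proof -
  have "{c \<in> diagram \<mu>. T c \<le> k} = (SIGMA i:{..<length \<mu>}. {j. j < row \<mu> i \<and> T (i, j) \<le> k})"
    by (auto simp: diagram_def row_def)
  then show ?thesis by (simp add: row_counts_def)
qed

lemma card_diagram: "card (diagram \<mu>) = sum_list \<mu>"
proof -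
  have "diagram \<mu> = (SIGMA i:{..<length \<mu>}. {..<row \<mu> i})"
    by (auto simp: diagram_def row_def)
  then show ?thesis by (simp add: sum_row)
qed

lemma row_counts_in_gt_patterns:
  assumes "is_partition \<mu>" "T \<in> semistandard_tableaux \<mu>"
    "\<forall>k. cumulative m k = card {c \<in> diagram \<mu>. T c \<le> k}"
  shows "row_counts \<mu> T \<in> gt_patterns \<mu> (cumulative m)"
proof -
  have pos: "T (i, j) \<ge> 1" if "j < row \<mu> i" for i j
    using assms(2) that unfolding semistandard_tableaux_def PiE_iff diagram_iff[symmetric] by auto
  \<comment> \<open>The cell above a cell of row \<open>Suc i\<close> lies in the diagram since the
    parts decrease, and its entry is strictly smaller.\<close>
  have "row_counts \<mu> T (Suc i) (Suc k) \<le> row_counts \<mu> T i k" for i k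
    unfolding row_counts_def
  proof (rule card_mono, simp, rule, safe)
    fix j assume j: "j < row \<mu> (Suc i)" "T (Suc i, j) \<le> Suc k"
    then show j': "j < row \<mu> i" using row_antimono[OF assms(1), of i "Suc i"] by simp
    then have "T (i, j) < T (Suc i, j)"
      using assms(2) j unfolding semistandard_tableaux_def diagram_iff by auto
    then show "T (i, j) \<le> k" using j by simp
  qed
  moreover have "row_counts \<mu> T i k \<le> row_counts \<mu> T i (Suc k)" for i k
    unfolding row_counts_def by (rule card_mono) auto
  moreover have "row_counts \<mu> T i 0 = 0" for i
    using pos[of _ i] by (force simp: row_counts_def)
  moreover have "row_counts \<mu> T i k \<le> row \<mu> i" for i k
    using card_mono[of "{..<row \<mu> i}" "{j. j < row \<mu> i \<and> T (i, j) \<le> k}"]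
    by (auto simp: row_counts_def)
  ultimately show ?thesis
    using assms(3) by (simp add: gt_patterns_def card_diagram_le)
qed

text \<open>Inverse of \<open>row_counts\<close>: the levels are a growing chain of shapes, and each
  cell is labelled with the time at which it is added.\<close>

definition tableau_of :: "nat list \<Rightarrow> (nat \<Rightarrow> nat \<Rightarrow> nat) \<Rightarrow> nat \<times> nat \<Rightarrow> nat" where
  "tableau_of \<mu> N = (\<lambda>(i, j) \<in> diagram \<mu>. LEAST k. j < N i k)"

text \<open>The level \<open>K\<close> guarantees that every cell of the shape is added at some
  time, so the least level exists; monotonicity in the level does the rest.\<close>

lemma tableau_of_le_iff:
  assumes "N \<in> gt_patterns \<mu> a" "a K = sum_list \<mu>" "j < row \<mu> i"
  shows "tableau_of \<mu> N (i, j) \<le> k \<longleftrightarrow> j < N i k"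
proof -
  have eq: "tableau_of \<mu> N (i, j) = (LEAST k. j < N i k)"
    using assms(3) by (simp add: tableau_of_def diagram_iff)
  have "j < N i K"
    using gt_pattern_full[OF assms(1,2)] assms(3) by simp
  then have "j < N i (tableau_of \<mu> N (i, j))"
    unfolding eq by (rule LeastI)
  then show ?thesis
    using gt_pattern_mono_level[OF assms(1)] eq
    by (metis Least_le order_less_le_trans)
qed

lemma row_counts_tableau_of:
  assumes "N \<in> gt_patterns \<mu> a" "a K = sum_list \<mu>"
  shows "row_counts \<mu> (tableau_of \<mu> N) = N"
proof (intro ext)
  fix i k
  have "{j. j < row \<mu> i \<and> tableau_of \<mu> N (i, j) \<le> k} = {..<N i k}"
    using tableau_of_le_iff[OF assms] gt_patternsD(4)[OF assms(1), of i k] by fastforce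
  then show "row_counts \<mu> (tableau_of \<mu> N) i k = N i k"
    by (simp add: row_counts_def)
qed

lemma tableau_of_semistandard:
  assumes "N \<in> gt_patterns \<mu> a" "a K = sum_list \<mu>"
  shows "tableau_of \<mu> N \<in> semistandard_tableaux \<mu>"
proof -
  note le_iff = tableau_of_le_iff[OF assms]
  have pos: "1 \<le> tableau_of \<mu> N (i, j)" if "j < row \<mu> i" for i j
    using le_iff[OF that, of 0] gt_patternsD(1)[OF assms(1)] by simp
  have rows: "tableau_of \<mu> N (i, j) \<le> tableau_of \<mu> N (i, j')"
    if "j < row \<mu> i" "j' < row \<mu> i" "j < j'" for i j j'
    using le_iff[OF that(1)] le_iff[OF that(2)] that(3) by (meson order.refl order.strict_trans)
  have cols: "tableau_of \<mu> N (i, j) < tableau_of \<mu> N (i', j)"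
    if j: "j < row \<mu> i" "j < row \<mu> i'" "i < i'" for i i' j
  proof -
    obtain k where k: "tableau_of \<mu> N (i', j) = Suc k"
      using pos[OF j(2)] by (cases "tableau_of \<mu> N (i', j)") auto
    then have "j < N i' (Suc k)"
      using le_iff[OF j(2), of "Suc k"] by simp
    then have "j < N i k"
      using gt_pattern_column_strict[OF assms(1) j(3), of k] by simp
    then show ?thesis using le_iff[OF j(1), of k] k by simp
  qed
  have "tableau_of \<mu> N \<in> diagram \<mu> \<rightarrow>\<^sub>E {1..}"
    using pos by (auto simp: PiE_iff diagram_iff) (auto simp: tableau_of_def)
  with rows cols show ?thesis
    unfolding semistandard_tableaux_def diagram_iff by blast
qed

lemma tableau_of_row_counts:
  assumes "T \<in> semistandard_tableaux \<mu>"
  shows "tableau_of \<mu> (row_counts \<mu> T) = T"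
proof (rule extensionalityI)
  show "tableau_of \<mu> (row_counts \<mu> T) \<in> extensional (diagram \<mu>)"
    by (simp add: tableau_of_def)
  show "T \<in> extensional (diagram \<mu>)"
    using assms by (simp add: semistandard_tableaux_def PiE_iff)
  fix c assume "c \<in> diagram \<mu>"
  moreover have "(LEAST k. t \<le> k) = t" for t :: nat
    by (rule Least_equality) auto
  ultimately show "tableau_of \<mu> (row_counts \<mu> T) c = T c"
    by (cases c) (simp add: tableau_of_def less_row_counts_iff[OF assms] diagram_iff)
qed

lemma schur_eq_card_gt_patterns:
  assumes "is_partition \<mu>" "size m = sum_list \<mu>"
  shows "schur \<mu> m = int (card (gt_patterns \<mu> (cumulative m)))"
proof -
  obtain K where K: "cumulative m K = sum_list \<mu>"
    using ex_cumulative_eq_size assms(2) by metis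
  let ?A = "{T \<in> semistandard_tableaux \<mu>. \<forall>i. count m i = card {c \<in> diagram \<mu>. T c = i}}"
  have A: "?A = {T \<in> semistandard_tableaux \<mu>. \<forall>k. cumulative m k = card {c \<in> diagram \<mu>. T c \<le> k}}"
    using content_iff_cumulative[OF finite_diagram, of m \<mu>] by (intro Collect_cong conj_cong) simp_all
  have "bij_betw (row_counts \<mu>) ?A (gt_patterns \<mu> (cumulative m))"
    unfolding A
  proof (rule bij_betwI)
    show "row_counts \<mu> \<in> {T \<in> semistandard_tableaux \<mu>. \<forall>k. cumulative m k = card {c \<in> diagram \<mu>. T c \<le> k}}
        \<rightarrow> gt_patterns \<mu> (cumulative m)"
      using row_counts_in_gt_patterns[OF assms(1)] by blast
    show "tableau_of \<mu> \<in> gt_patterns \<mu> (cumulative m) \<rightarrow>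
        {T \<in> semistandard_tableaux \<mu>. \<forall>k. cumulative m k = card {c \<in> diagram \<mu>. T c \<le> k}}"
      by (auto simp: tableau_of_semistandard[where a = "cumulative m", OF _ K] card_diagram_le
          row_counts_tableau_of[where a = "cumulative m", OF _ K] gt_patternsD(5))
  qed (auto simp: tableau_of_row_counts row_counts_tableau_of[where a = "cumulative m", OF _ K])
  then show ?thesis
    unfolding schur_def by (simp add: bij_betw_same_card)
qed

lemma schur_eq_0_if_0:
  assumes "0 \<in># m"
  shows "schur \<mu> m = 0"
proof -
  have "{T \<in> semistandard_tableaux \<mu>. \<forall>i. count m i = card {c \<in> diagram \<mu>. T c = i}} = {}"
  proof (rule ccontr)
    assume "\<not> ?thesis"
    then obtain T where T: "T \<in> semistandard_tableaux \<mu>" "count m 0 = card {c \<in> diagram \<mu>. T c = 0}"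
      by blast
    have "{c \<in> diagram \<mu>. T c = 0} = {}"
      using T(1) by (force simp: semistandard_tableaux_def PiE_iff)
    then have "count m 0 = 0"
      using T(2) by (simp only: card.empty)
    then show False
      using assms by (simp add: count_eq_zero_iff)
  qed
  then show ?thesis
    by (simp only: schur_def card.empty of_nat_0)
qed

lemma schur_eq_0_if_size:
  assumes "size m \<noteq> sum_list \<mu>"
  shows "schur \<mu> m = 0"
proof -
  have "{T \<in> semistandard_tableaux \<mu>. \<forall>i. count m i = card {c \<in> diagram \<mu>. T c = i}} = {}"
  proof (rule ccontr)
    assume "\<not> ?thesis"
    then obtain T where T: "\<forall>i. count m i = card {c \<in> diagram \<mu>. T c = i}"
      by blast
    \<comment> \<open>A level past all letters of \<open>m\<close> and all entries of
      \<open>T\<close>: there one cumulative count is the degree of \<open>m\<close> and the other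
      is the number of cells.\<close>
    let ?M = "Max (set_mset m \<union> T ` diagram \<mu>)"
    have "x \<le> ?M" if "x \<in> set_mset m \<union> T ` diagram \<mu>" for x
      using that by (intro Max_ge) (auto simp: finite_diagram)
    then have "cumulative m ?M = size m" "{c \<in> diagram \<mu>. T c \<le> ?M} = diagram \<mu>"
      by (auto intro!: cumulative_eq_size)
    then show False
      using T assms content_iff_cumulative[OF finite_diagram, of m \<mu> T] card_diagram by metis
  qed
  then show ?thesis
    by (simp only: schur_def card.empty of_nat_0)
qed

section \<open>Symmetry of Schur functions\<close>

text \<open>The adjacent transpositions start at the variables 1 and 2, so the excluded index 0 is
  never moved.\<close>

definition swap_content :: "nat \<Rightarrow> nat multiset \<Rightarrow> nat multiset" where
  "swap_content k = image_mset (transpose (Suc k) (Suc (Suc k)))"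

lemma size_swap_content [simp]: "size (swap_content k m) = size m"
  by (simp add: swap_content_def)

lemma count_swap_content: "count (swap_content k m) x = count m (transpose (Suc k) (Suc (Suc k)) x)"
proof -
  let ?t = "transpose (Suc k) (Suc (Suc k))"
  have "?t -` {x} = {?t x}"
    by (auto simp: transpose_eq_iff)
  then show ?thesis
    by (cases "?t x \<in># m") (simp_all add: swap_content_def count_image_mset not_in_iff)
qed

text \<open>Exchanging two consecutive increments of a sequence changes only the partial sum between
  them, which is reflected about the midpoint of its neighbours.\<close>

definition toggle_seq :: "nat \<Rightarrow> (nat \<Rightarrow> nat) \<Rightarrow> nat \<Rightarrow> nat" where
  "toggle_seq k a = a(Suc k := a k + a (Suc (Suc k)) - a (Suc k))"

lemma cumulative_swap_content: "cumulative (swap_content k m) = toggle_seq k (cumulative m)"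
proof
  fix l
  have below: "cumulative (swap_content k m) l = cumulative m l" if "l \<le> k" for l
    unfolding cumulative_def using that
    by (intro sum.cong) (auto simp: count_swap_content transpose_def)
  have at: "cumulative (swap_content k m) (Suc (Suc k)) = cumulative m (Suc (Suc k))"
    using below[of k] by (simp add: cumulative_Suc count_swap_content)
  have "cumulative (swap_content k m) (Suc (Suc k) + d) = cumulative m (Suc (Suc k) + d)" for d
    by (induction d) (use at in \<open>auto simp: cumulative_Suc count_swap_content transpose_def\<close>)
  then have above: "cumulative (swap_content k m) l = cumulative m l" if "Suc (Suc k) \<le> l" for l
    using that le_Suc_ex by metis
  consider "l \<le> k" | "l = Suc k" | "Suc (Suc k) \<le> l"
    by linarith
  then show "cumulative (swap_content k m) l = toggle_seq k (cumulative m) l"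
    by cases (use below[of l] below[of k] above[of l] in
      \<open>auto simp: toggle_seq_def cumulative_Suc count_swap_content\<close>)
qed

text \<open>
  The neighbouring levels confine \<open>N i (Suc k)\<close> to an interval. Reflecting it there for every row \<open>i\<close> is
  the Bender-Knuth involution: it exchanges the numbers of entries \<open>k + 1\<close> and \<open>k + 2\<close>.
\<close>

definition lower_bound :: "nat \<Rightarrow> (nat \<Rightarrow> nat \<Rightarrow> nat) \<Rightarrow> nat \<Rightarrow> nat" where
  "lower_bound k N i = max (N i k) (N (Suc i) (Suc (Suc k)))"

definition upper_bound :: "nat \<Rightarrow> (nat \<Rightarrow> nat \<Rightarrow> nat) \<Rightarrow> nat \<Rightarrow> nat" where
  "upper_bound k N i =
     (case i of 0 \<Rightarrow> N 0 (Suc (Suc k)) | Suc j \<Rightarrow> min (N (Suc j) (Suc (Suc k))) (N j k))"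

definition toggle :: "nat \<Rightarrow> (nat \<Rightarrow> nat \<Rightarrow> nat) \<Rightarrow> nat \<Rightarrow> nat \<Rightarrow> nat" where
  "toggle k N = (\<lambda>i. (N i)(Suc k := lower_bound k N i + upper_bound k N i - N i (Suc k)))"

lemma toggle_simps:
  "toggle k N i (Suc k) = lower_bound k N i + upper_bound k N i - N i (Suc k)"
  "l \<noteq> Suc k \<Longrightarrow> toggle k N i l = N i l"
  by (simp_all add: toggle_def)

lemma gt_pattern_bounds:
  assumes "N \<in> gt_patterns \<mu> a"
  shows "lower_bound k N i \<le> N i (Suc k)" "N i (Suc k) \<le> upper_bound k N i"
  using gt_patternsD(2,3)[OF assms] by (auto simp: lower_bound_def upper_bound_def split: nat.split)

text \<open>
  The upper bound of row \<open>i + 1\<close> and the lower bound of row \<open>i\<close> are the minimum and the maximum of the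
  same two numbers; hence the shift of the index.
\<close>

lemma sum_bounds:
  "(\<Sum>i<Suc l. upper_bound k N i) + (\<Sum>i<l. lower_bound k N i) =
   (\<Sum>i<Suc l. N i (Suc (Suc k))) + (\<Sum>i<l. N i k)"
  by (induction l) (auto simp: lower_bound_def upper_bound_def)

text \<open>The bounds depend only on the levels \<open>k\<close> and \<open>Suc (Suc k)\<close>,
  which the toggle leaves alone, so both reflections use the same intervals. The truncated
  subtraction is exact because each value lies in its interval.\<close>

lemma toggle_toggle:
  assumes "N \<in> gt_patterns \<mu> a"
  shows "toggle k (toggle k N) = N"
proof (intro ext)
  fix i l
  have "lower_bound k (toggle k N) = lower_bound k N" "upper_bound k (toggle k N) = upper_bound k N"
    by (auto simp: lower_bound_def upper_bound_def toggle_simps split: nat.split)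
  then show "toggle k (toggle k N) i l = N i l"
    using gt_pattern_bounds(1)[OF assms, of k i] gt_pattern_bounds(2)[OF assms, of i k] by (cases "l = Suc k") (auto simp: toggle_simps)
qed

text \<open>Monotonicity and interlacing restrict level \<open>Suc k\<close> exactly to the
  intervals between the bounds, so reflected values are again admissible. The level sum is reflected
  as well, by \<open>sum_bounds\<close>.\<close>

lemma toggle_in_gt_patterns:
  assumes "N \<in> gt_patterns \<mu> a"
  shows "toggle k N \<in> gt_patterns \<mu> (toggle_seq k a)"
proof -
  note D = gt_patternsD[OF assms]
  have lower: "lower_bound k N i \<le> toggle k N i (Suc k)"
    and upper: "toggle k N i (Suc k) \<le> upper_bound k N i" for i
    using gt_pattern_bounds(1)[OF assms, of k i] gt_pattern_bounds(2)[OF assms, of i k] by (auto simp: toggle_simps)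
  have upper': "upper_bound k N i \<le> N i (Suc (Suc k))" for i
    by (auto simp: upper_bound_def split: nat.split)
  have upper'': "upper_bound k N (Suc i) \<le> N i k" for i
    by (auto simp: upper_bound_def)
  have level: "toggle k N i l \<le> toggle k N i (Suc l)" for i l
  proof -
    consider "l = k" | "l = Suc k" | "l \<noteq> k" "l \<noteq> Suc k"
      by blast
    then show ?thesis
    proof cases
      case 1
      then show ?thesis using lower[of i] by (simp add: toggle_simps(2) lower_bound_def)
    next
      case 2
      then show ?thesis using order_trans[OF upper upper', of i] by (simp add: toggle_simps(2))
    qed (simp add: toggle_simps(2) D)
  qed
  have interlace: "toggle k N (Suc i) (Suc l) \<le> toggle k N i l" for i l
  proof -
    consider "l = k" | "l = Suc k" | "l \<noteq> k" "l \<noteq> Suc k"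
      by blast
    then show ?thesis
    proof cases
      case 1
      then show ?thesis using order_trans[OF upper upper'', of i] by (simp add: toggle_simps(2))
    next
      case 2
      then show ?thesis using lower[of i] by (simp add: toggle_simps(2) lower_bound_def)
    qed (simp add: toggle_simps(2) D)
  qed
  have bounded: "toggle k N i l \<le> row \<mu> i" for i l
    using order_trans[OF order_trans[OF upper upper'], of i] D(4)[of i]
    by (cases "l = Suc k") (simp_all add: toggle_simps(2))
  have "(\<Sum>i<length \<mu>. toggle k N i l) = toggle_seq k a l" for l
  proof (cases "l = Suc k")
    case True
    have "(\<Sum>i<length \<mu>. toggle k N i (Suc k)) + (\<Sum>i<length \<mu>. N i (Suc k)) =
        (\<Sum>i<length \<mu>. lower_bound k N i + upper_bound k N i)"
      unfolding sum.distrib[symmetric]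
      by (rule sum.cong) (use gt_pattern_bounds(2)[OF assms, of _ k] in \<open>auto simp: toggle_simps trans_le_add2\<close>)
    \<comment> \<open>The extra summand with index \<open>length \<mu>\<close> in
      \<open>sum_bounds\<close> vanishes on both sides, since the pattern is 0 below the
      shape.\<close>
    also have "\<dots> = (\<Sum>i<length \<mu>. N i (Suc (Suc k))) + (\<Sum>i<length \<mu>. N i k)"
      using sum_bounds[of k N "length \<mu>"] upper'[of "length \<mu>"] D(4)[of "length \<mu>" "Suc (Suc k)"]
      by (simp add: sum.distrib row_def)
    finally show ?thesis
      using True by (simp add: D(5) toggle_seq_def)
  qed (simp add: toggle_simps toggle_seq_def D)
  moreover have "toggle k N i 0 = 0" for i
    by (simp add: toggle_simps D)
  ultimately show ?thesis
    using level interlace bounded by (simp add: gt_patterns_def)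
qed

lemma schur_swap_content:
  assumes "is_partition \<mu>"
  shows "schur \<mu> (swap_content k m) = schur \<mu> m"
proof (cases "size m = sum_list \<mu>")
  case True
  let ?a = "cumulative m"
  \<comment> \<open>This makes the truncated subtraction exact, so that \<open>toggle_seq k\<close>
    undoes itself on this sequence.\<close>
  have "?a (Suc k) \<le> ?a k + ?a (Suc (Suc k))"
    using cumulative_mono[of "Suc k" "Suc (Suc k)" m] by simp
  then have inv: "toggle_seq k (toggle_seq k ?a) = ?a"
    by (auto simp: toggle_seq_def)
  have "bij_betw (toggle k) (gt_patterns \<mu> ?a) (gt_patterns \<mu> (toggle_seq k ?a))"
  proof (rule bij_betwI)
    show "toggle k \<in> gt_patterns \<mu> (toggle_seq k ?a) \<rightarrow> gt_patterns \<mu> ?a"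
      using toggle_in_gt_patterns[of _ \<mu> "toggle_seq k ?a" k] by (simp add: inv Pi_iff)
  qed (auto simp: toggle_in_gt_patterns toggle_toggle)
  then have "card (gt_patterns \<mu> ?a) = card (gt_patterns \<mu> (cumulative (swap_content k m)))"
    by (simp add: bij_betw_same_card cumulative_swap_content)
  then show ?thesis
    using True by (simp add: schur_eq_card_gt_patterns[OF assms])
qed (simp add: schur_eq_0_if_size)

text \<open>Adjacent transpositions generate all finite permutations of the variables. No bound on
  the degree is imposed, so the product over all variables qualifies.\<close>

definition symmetric :: "power_series \<Rightarrow> bool" where
  "symmetric f \<longleftrightarrow> (\<forall>m. 0 \<in># m \<longrightarrow> f m = 0) \<and> (\<forall>k m. f (swap_content k m) = f m)"

lemma symmetric_schur: "is_partition \<mu> \<Longrightarrow> symmetric (schur \<mu>)"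
  by (simp add: symmetric_def schur_eq_0_if_0 schur_swap_content)

section \<open>The Schur expansion\<close>

text \<open>The monomial with exponent vector \<mu>. The shift by one matches rows counted from 0
  with variables counted from 1.\<close>

definition dominant :: "nat list \<Rightarrow> nat multiset" where
  "dominant \<mu> = (\<Sum>i<length \<mu>. replicate_mset (\<mu> ! i) (Suc i))"

lemma count_dominant: "count (dominant \<mu>) 0 = 0" "count (dominant \<mu>) (Suc i) = row \<mu> i"
  by (auto simp: dominant_def count_sum row_def)

lemma size_dominant: "size (dominant \<mu>) = sum_list \<mu>"
  by (simp add: dominant_def size_multiset_sum sum_list_sum_nth lessThan_atLeast0)

lemma ex_dominant:
  assumes "0 \<notin># m" "\<And>k. count m (Suc (Suc k)) \<le> count m (Suc k)"
  shows "\<exists>\<mu> \<in> partitions (size m). dominant \<mu> = m"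
proof -
  define r where "r i = count m (Suc i)" for i
  have anti: "r j \<le> r i" if "i \<le> j" for i j
    by (rule lift_Suc_antimono_le[OF _ that]) (simp add: r_def assms)
  \<comment> \<open>A finite multiset cannot contain every positive index. Cutting at the first zero
    exponent leaves a list of positive parts, and monotonicity makes all later exponents 0.\<close>
  have "\<exists>i. r i = 0"
  proof (rule ccontr)
    assume "\<not> ?thesis"
    then have "range Suc \<subseteq> set_mset m"
      by (auto simp: r_def not_in_iff)
    then show False
      using finite_subset[of "range Suc" "set_mset m"] range_inj_infinite[of Suc] by simp
  qed
  then obtain n where n: "r n = 0" "\<And>i. i < n \<Longrightarrow> r i \<noteq> 0"
    using exists_least_iff[of "\<lambda>i. r i = 0"] by blast
  define \<mu> where "\<mu> = map r [0..<n]"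
  have row: "row \<mu> i = r i" for i
  proof (cases "i < n")
    case False
    then have "r i \<le> r n"
      by (intro anti) simp
    then show ?thesis
      using False n(1) by (simp add: row_def \<mu>_def)
  qed (simp add: row_def \<mu>_def)
  have "dominant \<mu> = m"
  proof (rule multiset_eqI)
    fix x show "count (dominant \<mu>) x = count m x"
      using assms(1) by (cases x) (simp_all add: count_dominant row r_def count_eq_zero_iff)
  qed
  moreover have "0 \<notin> set \<mu>"
    unfolding \<mu>_def set_map set_upt using n(2) by (metis atLeastLessThan_iff imageE)
  then have "is_partition \<mu>"
    using anti by (auto simp: is_partition_def \<mu>_def sorted_wrt_iff_nth_less)
  ultimately show ?thesis
    using size_dominant[of \<mu>] by (auto simp: partitions_def)
qed

text \<open>The termination measure for sorting exponents: moving the larger exponent to the smaller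
  index lowers the sum of the indices counted with multiplicity.\<close>

lemma sum_mset_swap_content:
  assumes "count m (Suc k) < count m (Suc (Suc k))"
  shows "sum_mset (swap_content k m) < sum_mset m"
proof -
  let ?p = "Suc k" and ?q = "Suc (Suc k)"
  define rest where "rest = filter_mset (\<lambda>x. x \<noteq> ?p \<and> x \<noteq> ?q) m"
  have m: "m = replicate_mset (count m ?p) ?p + replicate_mset (count m ?q) ?q + rest"
    by (rule multiset_eqI) (auto simp: rest_def)
  have "swap_content k rest = rest"
    unfolding swap_content_def by (rule multiset.map_ident_strong) (auto simp: rest_def transpose_def)
  then have "swap_content k m = replicate_mset (count m ?p) ?q + replicate_mset (count m ?q) ?p + rest"
    by (subst m) (simp add: swap_content_def)
  then have "sum_mset (swap_content k m) = count m ?p * ?q + count m ?q * ?p + sum_mset rest"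
    by (simp add: sum_mset_replicate_mset)
  also have "\<dots> < count m ?p * ?p + count m ?q * ?q + sum_mset rest"
    using assms by simp
  also have "\<dots> = sum_mset m"
    by (subst (3) m) (simp add: sum_mset_replicate_mset)
  finally show ?thesis .
qed

text \<open>Bubble sort of the exponents.\<close>

lemma symmetric_reduce:
  assumes "0 \<notin># m"
  shows "\<exists>\<mu> \<in> partitions (size m). \<forall>f. symmetric f \<longrightarrow> f m = f (dominant \<mu>)"
  using assms
proof (induction "sum_mset m" arbitrary: m rule: less_induct)
  case less
  show ?case
  proof (cases "\<exists>k. count m (Suc k) < count m (Suc (Suc k))")
    case True
    then obtain k where k: "count m (Suc k) < count m (Suc (Suc k))"
      by blast
    have "0 \<notin># swap_content k m"
      using less.prems by (simp add: not_in_iff count_swap_content transpose_def)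
    from less.hyps[OF sum_mset_swap_content[OF k] this] show ?thesis
      by (simp add: symmetric_def)
  next
    case False
    then obtain \<mu> where "\<mu> \<in> partitions (size m)" "dominant \<mu> = m"
      using ex_dominant[OF less.prems] by (meson not_le)
    then show ?thesis by blast
  qed
qed

section \<open>Kostka numbers and integral unitriangular systems\<close>

lemma cumulative_dominant: "cumulative (dominant \<mu>) k = (\<Sum>i<k. row \<mu> i)"
  by (induction k) (simp_all add: cumulative_Suc count_dominant, simp add: cumulative_def count_dominant)

text \<open>Column strictness confines the letters at most \<open>k\<close> to the first
  \<open>k\<close> rows of \<nu>, which must have room for all of them.\<close>

lemma schur_dominant_triangular:
  assumes "is_partition \<nu>" "schur \<nu> (dominant \<mu>) \<noteq> 0"
  shows "(\<Sum>i<k. row \<mu> i) \<le> (\<Sum>i<k. row \<nu> i)"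
proof -
  have "size (dominant \<mu>) = sum_list \<nu>"
    using assms(2) schur_eq_0_if_size by blast
  then have "gt_patterns \<nu> (cumulative (dominant \<mu>)) \<noteq> {}"
    using assms schur_eq_card_gt_patterns by fastforce
  then obtain N where N: "N \<in> gt_patterns \<nu> (cumulative (dominant \<mu>))"
    by blast
  have "(\<Sum>i<k. row \<mu> i) = (\<Sum>i<length \<nu>. N i k)"
    using gt_patternsD(5)[OF N] by (simp add: cumulative_dominant)
  also have "\<dots> = (\<Sum>i \<in> {..<length \<nu>} \<inter> {..<k}. N i k)"
    by (rule sum.mono_neutral_right) (use gt_pattern_eq_0[OF N, of k] in \<open>auto simp: not_less[symmetric]\<close>)
  also have "\<dots> \<le> (\<Sum>i \<in> {..<length \<nu>} \<inter> {..<k}. row \<nu> i)"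
    by (rule sum_mono) (rule gt_patternsD(4)[OF N])
  also have "\<dots> \<le> (\<Sum>i<k. row \<nu> i)"
    by (rule sum_mono2) auto
  finally show ?thesis .
qed

lemma schur_dominant_diagonal:
  assumes "is_partition \<mu>"
  shows "schur \<mu> (dominant \<mu>) = 1"
proof -
  \<comment> \<open>The pattern of the tableau whose row \<open>i\<close> is filled with the letter
    \<open>Suc i\<close>. Any pattern of this content lies below it entrywise and has the same level
    sums, hence equals it.\<close>
  define M where "M i k = (if i < k then row \<mu> i else 0)" for i k :: nat
  have sum_M: "(\<Sum>i<length \<mu>. M i k) = (\<Sum>i<k. row \<mu> i)" for k
  proof -
    have "(\<Sum>i<length \<mu>. M i k) = (\<Sum>i \<in> {..<length \<mu>} \<inter> {..<k}. row \<mu> i)"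
      by (rule sum.mono_neutral_cong_right) (auto simp: M_def)
    also have "\<dots> = (\<Sum>i<k. row \<mu> i)"
      by (rule sum.mono_neutral_left) (auto simp: row_def)
    finally show ?thesis .
  qed
  have "gt_patterns \<mu> (cumulative (dominant \<mu>)) = {M}"
  proof (intro equalityI subsetI)
    fix N assume N: "N \<in> gt_patterns \<mu> (cumulative (dominant \<mu>))"
    have le: "N i k \<le> M i k" for i k
      using gt_pattern_eq_0[OF N, of k i] gt_patternsD(4)[OF N, of i k] by (auto simp: M_def)
    have "N i k = M i k" for i k
    proof (cases "i < length \<mu>")
      case True
      show ?thesis
        by (rule sum_lessThan_eq_imp_eq[OF le _ True])
          (simp add: gt_patternsD(5)[OF N] sum_M cumulative_dominant)
    next
      case False
      then show ?thesis using le[of i k] by (simp add: M_def row_def split: if_splits)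
    qed
    then show "N \<in> {M}" by blast
  next
    fix N assume "N \<in> {M}"
    moreover have "row \<mu> (Suc i) \<le> row \<mu> i" for i
      by (rule row_antimono[OF assms]) simp
    ultimately show "N \<in> gt_patterns \<mu> (cumulative (dominant \<mu>))"
      by (simp add: gt_patterns_def sum_M cumulative_dominant, simp add: M_def)
  qed
  then show ?thesis
    by (simp add: schur_eq_card_gt_patterns[OF assms size_dominant])
qed

text \<open>Elimination beginning at an element \<open>x\<close> of largest rank: its equation
  involves only \<open>c x\<close> and forces \<open>c x = f x\<close>; the contribution of
  \<open>x\<close> is then subtracted from the other equations. The unit diagonal keeps the solution
  integral.\<close>

lemma unitriangular_solution:
  fixes K :: "'a \<Rightarrow> 'a \<Rightarrow> int" and r :: "'a \<Rightarrow> nat"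
  assumes "finite P"
    and "\<And>x. x \<in> P \<Longrightarrow> K x x = 1"
    and "\<And>x y. x \<in> P \<Longrightarrow> y \<in> P \<Longrightarrow> x \<noteq> y \<Longrightarrow> K x y \<noteq> 0 \<Longrightarrow> r y < r x"
  shows "\<exists>c. \<forall>y\<in>P. (\<Sum>x\<in>P. c x * K x y) = f y"
  using assms
proof (induction P arbitrary: f rule: finite_ranking_induct[where f = r])
  case empty
  then show ?case by simp
next
  case (insert x S)
  show ?case
  proof (cases "x \<in> S")
    case True
    then show ?thesis
      using insert.IH insert.prems by (simp add: insert_absorb)
  next
    case False
    have 0: "K y x = 0" if "y \<in> S" for y
      using insert.prems(2)[of y x] insert.hyps(2)[OF that] that False by fastforce
    have "\<exists>c. \<forall>y\<in>S. (\<Sum>z\<in>S. c z * K z y) = f y - f x * K x y"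
      by (rule insert.IH) (use insert.prems in auto)
    then obtain c where c: "\<And>y. y \<in> S \<Longrightarrow> (\<Sum>z\<in>S. c z * K z y) = f y - f x * K x y"
      by blast
    have "(\<Sum>z\<in>insert x S. (c(x := f x)) z * K z y) = f x * K x y + (\<Sum>z\<in>S. c z * K z y)" for y
      using insert.hyps(1) False by (auto intro!: sum.cong)
    then have "\<forall>y\<in>insert x S. (\<Sum>z\<in>insert x S. (c(x := f x)) z * K z y) = f y"
      using c 0 insert.prems(1)[of x] by auto
    then show ?thesis by blast
  qed
qed

text \<open>The same elimination with right-hand side 0: the equation at an element of largest rank
  makes its coefficient vanish, and this element drops out of the remaining sums.\<close>

lemma unitriangular_unique:
  fixes K :: "'a \<Rightarrow> 'a \<Rightarrow> int" and r :: "'a \<Rightarrow> nat"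
  assumes "finite P"
    and "\<And>x. x \<in> P \<Longrightarrow> K x x = 1"
    and "\<And>x y. x \<in> P \<Longrightarrow> y \<in> P \<Longrightarrow> x \<noteq> y \<Longrightarrow> K x y \<noteq> 0 \<Longrightarrow> r y < r x"
    and "\<And>y. y \<in> P \<Longrightarrow> (\<Sum>x\<in>P. c x * K x y) = 0" "x \<in> P"
  shows "c x = 0"
  using assms
proof (induction P arbitrary: x rule: finite_ranking_induct[where f = r])
  case empty
  then show ?case by simp
next
  case (insert z S)
  show ?case
  proof (cases "z \<in> S")
    case True
    then show ?thesis
      using insert.IH insert.prems by (simp add: insert_absorb)
  next
    case False
    have 0: "K y z = 0" if "y \<in> S" for y
      using insert.prems(2)[of y z] insert.hyps(2)[OF that] that False by fastforce
    have z: "c z = 0"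
      using insert.prems(3)[of z] insert.prems(1)[of z] insert.hyps(1) False 0 by simp
    have "c x = 0" if "x \<in> S"
      by (rule insert.IH) (use insert.prems insert.hyps(1) False z that in auto)
    then show ?thesis using z insert.prems(4) by blast
  qed
qed

text \<open>The sum of all partial row sums refines dominance order to a ranking by natural numbers.\<close>

lemma row_sums_strict:
  assumes "\<mu> \<in> partitions n" "\<nu> \<in> partitions n" "\<mu> \<noteq> \<nu>"
    and le: "\<And>k. (\<Sum>i<k. row \<mu> i) \<le> (\<Sum>i<k. row \<nu> i)"
  shows "(\<Sum>k\<le>n. \<Sum>i<k. row \<mu> i) < (\<Sum>k\<le>n. \<Sum>i<k. row \<nu> i)"
proof (rule ccontr)
  assume "\<not> ?thesis"
  then have "(\<Sum>k\<le>n. \<Sum>i<k. row \<mu> i) = (\<Sum>k\<le>n. \<Sum>i<k. row \<nu> i)"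
    using sum_mono[of "{..n}", OF le] by (simp add: not_less order_antisym)
  then have eq: "(\<Sum>i<k. row \<mu> i) = (\<Sum>i<k. row \<nu> i)" if "k \<le> n" for k
    using sum_mono_inv[of "\<lambda>k. \<Sum>i<k. row \<mu> i" "{..n}" "\<lambda>k. \<Sum>i<k. row \<nu> i" k] le that by auto
  have part: "is_partition \<mu>" "is_partition \<nu>" "length \<mu> \<le> n" "length \<nu> \<le> n"
    using assms(1,2) length_le_sum_list[of \<mu>] length_le_sum_list[of \<nu>]
    by (auto simp: partitions_def is_partition_def)
  have "row \<mu> i = row \<nu> i" for i
  proof (cases "i < n")
    case True
    then show ?thesis using eq[of i] eq[of "Suc i"] by simp
  next
    case False
    then show ?thesis using part by (simp add: row_def)
  qed
  then show False using partition_eqI part assms(3) by blast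
qed

lemma schur_unitriangular:
  shows "\<mu> \<in> partitions n \<Longrightarrow> schur \<mu> (dominant \<mu>) = 1"
    and "\<mu> \<in> partitions n \<Longrightarrow> \<nu> \<in> partitions n \<Longrightarrow> \<nu> \<noteq> \<mu> \<Longrightarrow> schur \<nu> (dominant \<mu>) \<noteq> 0 \<Longrightarrow>
      (\<Sum>k\<le>n. \<Sum>i<k. row \<mu> i) < (\<Sum>k\<le>n. \<Sum>i<k. row \<nu> i)"
  using row_sums_strict[of \<mu> n \<nu>] schur_dominant_triangular[of \<nu> \<mu>]
  by (auto simp: partitions_def schur_dominant_diagonal)

section \<open>Existence and uniqueness of Schur coefficients\<close>

lemma schur_expansion_unique:
  assumes "\<And>m. (\<Sum>\<nu> \<in> partitions n. c \<nu> * schur \<nu> m) = (\<Sum>\<nu> \<in> partitions n. d \<nu> * schur \<nu> m)"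
    and "\<mu> \<in> partitions n"
  shows "c \<mu> = d \<mu>"
proof -
  have "c \<mu> - d \<mu> = 0"
  proof (rule unitriangular_unique[where K = "\<lambda>\<nu> \<mu>. schur \<nu> (dominant \<mu>)" and P = "partitions n"
        and c = "\<lambda>\<nu>. c \<nu> - d \<nu>" and r = "\<lambda>\<mu>. \<Sum>k\<le>n. \<Sum>i<k. row \<mu> i"])
    fix \<nu>
    show "(\<Sum>x\<in>partitions n. (c x - d x) * schur x (dominant \<nu>)) = 0"
      using assms(1)[of "dominant \<nu>"] by (simp add: left_diff_distrib sum_subtractf)
  qed (use assms(2) finite_partitions schur_unitriangular in auto)
  then show ?thesis by simp
qed

text \<open>The coefficients are found by solving the unitriangular system on the dominant
  monomials; symmetry of both sides carries the equality to all other monomials.\<close>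

lemma schur_expansion_exists:
  assumes "symmetric f"
  shows "\<exists>c. homogeneous_component n f = (\<lambda>m. \<Sum>\<nu> \<in> partitions n. c \<nu> * schur \<nu> m)"
proof -
  have "\<exists>c. \<forall>\<mu> \<in> partitions n. (\<Sum>\<nu>\<in>partitions n. c \<nu> * schur \<nu> (dominant \<mu>)) = f (dominant \<mu>)"
    by (rule unitriangular_solution[where r = "\<lambda>\<mu>. \<Sum>k\<le>n. \<Sum>i<k. row \<mu> i"])
      (use finite_partitions schur_unitriangular in auto)
  then obtain c where c: "\<And>\<mu>. \<mu> \<in> partitions n \<Longrightarrow>
      (\<Sum>\<nu>\<in>partitions n. c \<nu> * schur \<nu> (dominant \<mu>)) = f (dominant \<mu>)"
    by blast
  have "homogeneous_component n f m = (\<Sum>\<nu> \<in> partitions n. c \<nu> * schur \<nu> m)" for m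
  proof (cases "size m = n \<and> 0 \<notin># m")
    case True
    then obtain \<mu> where \<mu>: "\<mu> \<in> partitions n" "\<And>g. symmetric g \<Longrightarrow> g m = g (dominant \<mu>)"
      using symmetric_reduce by blast
    have "(\<Sum>\<nu> \<in> partitions n. c \<nu> * schur \<nu> m) = (\<Sum>\<nu>\<in>partitions n. c \<nu> * schur \<nu> (dominant \<mu>))"
      by (rule sum.cong) (auto simp: \<mu>(2)[OF symmetric_schur] partitions_def)
    then show ?thesis
      using True c[OF \<mu>(1)] \<mu>(2)[OF assms] by (simp add: homogeneous_component_def)
  next
    case False
    then have "homogeneous_component n f m = 0"
      using assms by (auto simp: homogeneous_component_def symmetric_def)
    moreover have "(\<Sum>\<nu> \<in> partitions n. c \<nu> * schur \<nu> m) = 0"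
      by (rule sum.neutral) (use False schur_eq_0_if_0 schur_eq_0_if_size in \<open>auto simp: partitions_def\<close>)
    ultimately show ?thesis by simp
  qed
  then show ?thesis by blast
qed

text \<open>Uniqueness of the expansion justifies the definite description in
  \<open>schur_coeff\<close>.\<close>

lemma schur_coeff_eqI:
  assumes "is_partition \<mu>" "sum_list \<mu> = n"
    and "homogeneous_component n f = (\<lambda>m. \<Sum>\<nu> \<in> partitions n. c \<nu> * schur \<nu> m)"
  shows "schur_coeff \<mu> f = c \<mu>"
  unfolding schur_coeff_def
proof (rule the_equality)
  show "\<exists>c'. c' \<mu> = c \<mu> \<and> homogeneous_component (sum_list \<mu>) f =
      (\<lambda>m. \<Sum>\<nu> \<in> partitions (sum_list \<mu>). c' \<nu> * schur \<nu> m)"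
    using assms by blast
next
  fix a assume "\<exists>c'. c' \<mu> = a \<and> homogeneous_component (sum_list \<mu>) f =
      (\<lambda>m. \<Sum>\<nu> \<in> partitions (sum_list \<mu>). c' \<nu> * schur \<nu> m)"
  then obtain c' where c': "c' \<mu> = a" "homogeneous_component n f =
      (\<lambda>m. \<Sum>\<nu> \<in> partitions n. c' \<nu> * schur \<nu> m)"
    using assms(2) by blast
  have "c' \<mu> = c \<mu>"
    by (rule schur_expansion_unique[where n = n]) (use c'(2) assms in \<open>auto simp: partitions_def fun_eq_iff\<close>)
  then show "a = c \<mu>" using c'(1) by simp
qed

section \<open>Restriction to two variables\<close>

definition two_variable :: "nat \<Rightarrow> nat \<Rightarrow> nat multiset" where
  "two_variable p q = replicate_mset p 1 + replicate_mset q 2"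

lemma cumulative_two_variable:
  "cumulative (two_variable p q) 0 = 0"
  "cumulative (two_variable p q) (Suc 0) = p"
  "cumulative (two_variable p q) (Suc (Suc k)) = p + q"
proof -
  show "cumulative (two_variable p q) (Suc (Suc k)) = p + q"
    by (induction k) (simp_all add: cumulative_def two_variable_def numeral_2_eq_2)
qed (simp_all add: cumulative_def two_variable_def)

text \<open>Level 0 is empty, level 1 has only its first row free, with value \<open>p\<close>, and
  from level 2 on the shape is complete. So there is one candidate, and the three conditions say
  that it interlaces.\<close>

lemma schur_two_variable:
  assumes "\<nu> \<in> partitions (p + q)"
  shows "schur \<nu> (two_variable p q) = (if row \<nu> 2 = 0 \<and> row \<nu> 1 \<le> p \<and> p \<le> row \<nu> 0 then 1 else 0)"
proof -
  have \<nu>: "is_partition \<nu>" "sum_list \<nu> = p + q"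
    using assms by (auto simp: partitions_def)
  let ?a = "cumulative (two_variable p q)"
  let ?cond = "row \<nu> 2 = 0 \<and> row \<nu> 1 \<le> p \<and> p \<le> row \<nu> 0"
  define M where "M i k = (case k of 0 \<Rightarrow> 0 | Suc 0 \<Rightarrow> if i = 0 then p else 0 | Suc (Suc _) \<Rightarrow> row \<nu> i)"
    for i k :: nat
  have M_simps: "M i 0 = 0" "M i (Suc 0) = (if i = 0 then p else 0)" "M i (Suc (Suc k)) = row \<nu> i" for i k
    by (simp_all add: M_def)
  have unique: "N = M" if N: "N \<in> gt_patterns \<nu> ?a" for N
  proof (intro ext)
    fix i k
    consider "k = 0" | "k = Suc 0" | l where "k = Suc (Suc l)"
      by (metis not0_implies_Suc)
    then show "N i k = M i k"
    proof cases
      case 1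
      then show ?thesis by (simp add: M_simps gt_patternsD(1)[OF N])
    next
      case 2
      have 0: "N j (Suc 0) = 0" if "j > 0" for j
        using gt_pattern_eq_0[OF N, of "Suc 0" j] that by simp
      have "(\<Sum>j<length \<nu>. N j (Suc 0)) = (\<Sum>j<length \<nu>. if j = 0 then N 0 (Suc 0) else 0)"
        by (rule sum.cong) (auto simp: 0)
      then have "(if 0 < length \<nu> then N 0 (Suc 0) else 0) = p"
        using gt_patternsD(5)[OF N, of "Suc 0"] by (simp add: cumulative_two_variable)
      moreover have "N 0 (Suc 0) = 0" if "length \<nu> = 0"
        using gt_patternsD(4)[OF N, of 0 "Suc 0"] that by (simp add: row_def)
      ultimately have "N 0 (Suc 0) = p"
        by (cases "0 < length \<nu>") auto
      with 2 0 show ?thesis by (simp add: M_simps)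
    next
      case 3
      then show ?thesis
        using gt_pattern_full[OF N] \<nu>(2) by (simp add: M_simps cumulative_two_variable)
    qed
  qed
  have cond: ?cond if "M \<in> gt_patterns \<nu> ?a"
    using gt_pattern_eq_0[OF that, of 2 2] gt_patternsD(3)[OF that, of 0 "Suc 0"]
      gt_patternsD(2)[OF that, of 0 "Suc 0"]
    by (simp add: M_simps numeral_2_eq_2)
  have mem: "M \<in> gt_patterns \<nu> ?a" if c: ?cond
  proof -
    have "M i k \<le> M i (Suc k)" for i k
      using c by (auto simp: M_def split: nat.split)
    moreover have "M (Suc i) (Suc k) \<le> M i k" for i k
    proof -
      consider "k = 0" | "k = Suc 0" | l where "k = Suc (Suc l)"
        by (metis not0_implies_Suc)
      then show ?thesis
      proof cases
        case 2
        have "row \<nu> (Suc i) = 0" if "i > 0"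
          using c row_antimono[OF \<nu>(1), of 2 "Suc i"] that by simp
        then show ?thesis using 2 c by (auto simp: M_simps)
      next
        case 3
        then show ?thesis using row_antimono[OF \<nu>(1), of i "Suc i"] by (simp add: M_simps)
      qed (simp add: M_simps)
    qed
    moreover have "M i k \<le> row \<nu> i" for i k
      using c by (auto simp: M_def split: nat.split)
    moreover have "(\<Sum>i<length \<nu>. M i k) = ?a k" for k
    proof -
      consider "k = 0" | "k = Suc 0" | l where "k = Suc (Suc l)"
        by (metis not0_implies_Suc)
      then show ?thesis
      proof cases
        case 2
        have "p = 0" if "\<nu> = []"
          using c that by (simp add: row_def)
        then show ?thesis using 2 by (auto simp: M_simps cumulative_two_variable)
      qed (simp_all add: M_simps cumulative_two_variable sum_row \<nu>)
    qed
    ultimately show ?thesis by (simp add: gt_patterns_def M_simps)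
  qed
  have "gt_patterns \<nu> ?a = (if ?cond then {M} else {})"
  proof (cases ?cond)
    case True
    then show ?thesis unfolding if_P[OF True] using unique mem[OF True] by blast
  next
    case False
    then show ?thesis unfolding if_not_P[OF False] using unique cond by blast
  qed
  moreover have "size (two_variable p q) = sum_list \<nu>"
    using \<nu> by (simp add: two_variable_def)
  ultimately show ?thesis
    using schur_eq_card_gt_patterns[OF \<nu>(1)] by simp
qed

lemma two_variable_expansion:
  assumes "homogeneous_component n f = (\<lambda>m. \<Sum>\<nu> \<in> partitions n. c \<nu> * schur \<nu> m)"
    and "p + q = n" "q \<le> p"
  shows "f (two_variable p q) = (\<Sum>\<nu> \<in> {\<nu> \<in> partitions n. row \<nu> 2 = 0 \<and> p \<le> row \<nu> 0}. c \<nu>)"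
proof -
  have "f (two_variable p q) = homogeneous_component n f (two_variable p q)"
    using assms(2) by (simp add: homogeneous_component_def two_variable_def)
  also have "\<dots> = (\<Sum>\<nu> \<in> partitions n. if row \<nu> 2 = 0 \<and> p \<le> row \<nu> 0 then c \<nu> else 0)"
    unfolding assms(1)
  proof (rule sum.cong)
    fix \<nu> assume \<nu>: "\<nu> \<in> partitions n"
    \<comment> \<open>A first row of length at least \<open>p\<close> leaves at most
      \<open>q\<close> cells for the second, and \<open>q \<le> p\<close>. Only the bound on the
      first row remains as a condition.\<close>
    have "row \<nu> 1 \<le> p" if "row \<nu> 2 = 0" "p \<le> row \<nu> 0"
    proof -
      have "length \<nu> \<le> 2"
        using \<nu> that(1) by (simp add: row_eq_0_iff partitions_def)
      then have "(\<Sum>i<2. row \<nu> i) = n"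
        using \<nu> by (simp add: sum_row_ge partitions_def)
      then show ?thesis
        using that(2) assms(2,3) by (simp add: numeral_2_eq_2)
    qed
    then show "c \<nu> * schur \<nu> (two_variable p q) = (if row \<nu> 2 = 0 \<and> p \<le> row \<nu> 0 then c \<nu> else 0)"
      using schur_two_variable[of \<nu> p q] \<nu> assms(2) by auto
  qed simp
  also have "\<dots> = (\<Sum>\<nu> \<in> {\<nu> \<in> partitions n. row \<nu> 2 = 0 \<and> p \<le> row \<nu> 0}. c \<nu>)"
    by (simp add: sum.If_cases finite_partitions Int_def conj_assoc)
  finally show ?thesis .
qed

text \<open>Raising \<open>p\<close> by one removes exactly \<mu> from the shapes that contribute,
  so the difference of two neighbouring values isolates its coefficient. For \<open>q = 0\<close> no
  shape is left after the removal, while the truncated \<open>q - 1\<close> would give a monomial of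
  the wrong degree.\<close>

lemma schur_coeff_two_rows:
  assumes "symmetric f" "is_partition \<mu>" "length \<mu> \<le> 2"
  defines "p \<equiv> row \<mu> 0" and "q \<equiv> row \<mu> 1"
  shows "schur_coeff \<mu> f =
    f (two_variable p q) - (if q = 0 then 0 else f (two_variable (Suc p) (q - 1)))"
proof -
  define n where "n = sum_list \<mu>"
  have pq: "p + q = n"
    using sum_row_ge[OF assms(3)] by (simp add: p_def q_def n_def numeral_2_eq_2)
  have "q \<le> p"
    using row_antimono[OF assms(2), of 0 1] by (simp add: p_def q_def)
  define A where "A r = {\<nu> \<in> partitions n. row \<nu> 2 = 0 \<and> r \<le> row \<nu> 0}" for r
  have fin: "finite (A r)" for r
    by (simp add: A_def finite_partitions)
  have two: "row \<nu> 0 + row \<nu> 1 = n" "row \<nu> (Suc (Suc i)) = 0"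
    if "\<nu> \<in> partitions n" "row \<nu> 2 = 0" for \<nu> i
  proof -
    have l: "length \<nu> \<le> 2"
      using that by (simp add: row_eq_0_iff partitions_def)
    show "row \<nu> 0 + row \<nu> 1 = n"
      using that(1) sum_row_ge[OF l] by (simp add: partitions_def numeral_2_eq_2)
    show "row \<nu> (Suc (Suc i)) = 0"
      using l by (simp add: row_def)
  qed
  have \<mu>: "\<mu> \<in> partitions n" "row \<mu> 2 = 0"
    using assms(2,3) by (auto simp: n_def partitions_def row_def)
  have A_Suc: "A p = insert \<mu> (A (Suc p))"
  proof
    show "insert \<mu> (A (Suc p)) \<subseteq> A p"
      using \<mu> by (auto simp: A_def p_def)
    show "A p \<subseteq> insert \<mu> (A (Suc p))"
    proof
      fix \<nu> assume \<nu>: "\<nu> \<in> A p"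
      show "\<nu> \<in> insert \<mu> (A (Suc p))"
      proof (cases "row \<nu> 0 = p")
        case True
        have "row \<nu> i = row \<mu> i" for i
        proof -
          consider "i = 0" | "i = 1" | j where "i = Suc (Suc j)"
            by (metis One_nat_def not0_implies_Suc)
          then show ?thesis
            by cases (use True \<nu> \<mu> two[of \<nu>] two[of \<mu>] in \<open>auto simp: p_def A_def\<close>)
        qed
        then have "\<nu> = \<mu>"
          using partition_eqI \<mu> \<nu> by (simp add: A_def partitions_def)
        then show ?thesis by simp
      qed (use \<nu> in \<open>auto simp: A_def\<close>)
    qed
  qed
  have "\<mu> \<notin> A (Suc p)"
    by (simp add: A_def p_def)
  obtain c where c: "homogeneous_component n f = (\<lambda>m. \<Sum>\<nu> \<in> partitions n. c \<nu> * schur \<nu> m)"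
    using schur_expansion_exists[OF assms(1)] by blast
  have "f (two_variable p q) = c \<mu> + (\<Sum>\<nu>\<in>A (Suc p). c \<nu>)"
    using two_variable_expansion[OF c pq \<open>q \<le> p\<close>] \<open>\<mu> \<notin> A (Suc p)\<close> fin[of "Suc p"]
    unfolding A_def[symmetric] A_Suc by simp
  moreover have "(\<Sum>\<nu>\<in>A (Suc p). c \<nu>) = (if q = 0 then 0 else f (two_variable (Suc p) (q - 1)))"
  proof (cases "q = 0")
    case True
    then have "A (Suc p) = {}"
      using two(1) pq by (fastforce simp: A_def)
    then show ?thesis using True by simp
  next
    case False
    then show ?thesis
      using two_variable_expansion[OF c, of "Suc p" "q - 1"] pq \<open>q \<le> p\<close> by (simp add: A_def)
  qed
  moreover have "schur_coeff \<mu> f = c \<mu>"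
    using schur_coeff_eqI[OF assms(2) n_def[symmetric] c] .
  ultimately show ?thesis by simp
qed

section \<open>The series of a graph\<close>

text \<open>Transposing two variables only permutes the factors. Running over the occurring
  variables alone keeps the product finite.\<close>

lemma symmetric_content_prod:
  fixes h :: "nat \<Rightarrow> int"
  shows "symmetric (\<lambda>m. if 0 \<in># m then 0 else \<Prod>x\<in>set_mset m. h (count m x))"
proof -
  have "(\<Prod>x\<in>set_mset (swap_content k m). h (count (swap_content k m) x)) = (\<Prod>x\<in>set_mset m. h (count m x))"
    for k m
  proof -
    let ?t = "transpose (Suc k) (Suc (Suc k))"
    have "set_mset (swap_content k m) = ?t ` set_mset m"
      by (simp add: swap_content_def)
    then show ?thesis
      by (simp add: prod.reindex count_swap_content)
  qed
  moreover have "0 \<in># swap_content k m \<longleftrightarrow> 0 \<in># m" for k m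
    using count_swap_content[of k m 0] by (simp flip: count_greater_zero_iff)
  ultimately show ?thesis
    by (simp add: symmetric_def)
qed

definition independent_count :: "('a, 'b) pre_digraph \<Rightarrow> nat \<Rightarrow> nat" where
  "independent_count G j = card {S \<in> independent_sets G. card S = j}"

lemma (in graph) finite_independent_sets: "finite (independent_sets G)"
  by (rule finite_subset[of _ "Pow (verts G)"]) (auto simp: independent_sets_def)

lemma (in graph) independent_count_0: "independent_count G 0 = 1"
proof -
  have "{S \<in> independent_sets G. card S = 0} = {{}}"
    using finite_subset[OF _ finite_verts] by (auto simp: independent_sets_def)
  then show ?thesis
    by (simp only: independent_count_def card.empty card_insert_disjoint finite.emptyI)
      simp
qed

definition colorings_of_content :: "('a, 'b) pre_digraph \<Rightarrow> nat multiset \<Rightarrow> ('a \<Rightarrow> nat set) set" where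
  "colorings_of_content G m = {\<kappa> \<in> verts G \<rightarrow>\<^sub>E {S. finite S \<and> S \<subseteq> {1..}}.
     (\<forall>u v. u \<rightarrow>\<^bsub>G\<^esub> v \<longrightarrow> \<kappa> u \<inter> \<kappa> v = {}) \<and> (\<forall>i. count m i = card {v \<in> verts G. i \<in> \<kappa> v})}"

text \<open>Each multicoloring has exactly one type, so the sum over all \<alpha> counts a disjoint
  union.\<close>

lemma Y_series_eq_card:
  assumes "finite (verts G)"
  shows "Y_series G m = int (card (colorings_of_content G m))"
proof -
  define C where "C \<alpha> = {\<kappa> \<in> proper_multicolorings G \<alpha>. \<forall>i. count m i = card {v \<in> verts G. i \<in> \<kappa> v}}" for \<alpha>
  have X: "X_series G \<alpha> m = int (card (C \<alpha>))" for \<alpha>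
    by (simp add: X_series_def C_def)
  have fin: "finite (C \<alpha>)" for \<alpha>
    unfolding C_def by (rule finite_proper_multicolorings_of_content[OF assms])
  let ?I = "{\<alpha> \<in> verts G \<rightarrow>\<^sub>E UNIV. X_series G \<alpha> m \<noteq> 0}"
  have disj: "C \<alpha> \<inter> C \<beta> = {}" if "\<alpha> \<in> ?I" "\<beta> \<in> ?I" "\<alpha> \<noteq> \<beta>" for \<alpha> \<beta>
  proof (rule ccontr)
    assume "C \<alpha> \<inter> C \<beta> \<noteq> {}"
    then obtain \<kappa> where "\<kappa> \<in> C \<alpha>" "\<kappa> \<in> C \<beta>"
      by blast
    then have "\<alpha> v = \<beta> v" if "v \<in> verts G" for v
      using that by (simp add: C_def proper_multicolorings_def multicolorings_def)
    then show False
      using that PiE_ext[of \<alpha> "verts G" "\<lambda>_. UNIV" \<beta>] by auto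
  qed
  have "(\<Union>\<alpha>\<in>?I. C \<alpha>) = colorings_of_content G m"
  proof
    show "(\<Union>\<alpha>\<in>?I. C \<alpha>) \<subseteq> colorings_of_content G m"
      by (auto simp: C_def colorings_of_content_def proper_multicolorings_def multicolorings_def)
    show "colorings_of_content G m \<subseteq> (\<Union>\<alpha>\<in>?I. C \<alpha>)"
    proof
      fix \<kappa> assume \<kappa>: "\<kappa> \<in> colorings_of_content G m"
      define \<alpha> where "\<alpha> = (\<lambda>v \<in> verts G. card (\<kappa> v))"
      have "\<kappa> \<in> C \<alpha>"
        using \<kappa> by (auto simp: C_def colorings_of_content_def proper_multicolorings_def multicolorings_def \<alpha>_def)
      moreover from this have "X_series G \<alpha> m \<noteq> 0"
        using fin[of \<alpha>] by (auto simp: X)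
      moreover have "\<alpha> \<in> verts G \<rightarrow>\<^sub>E UNIV"
        by (simp add: \<alpha>_def)
      ultimately show "\<kappa> \<in> (\<Union>\<alpha>\<in>?I. C \<alpha>)" by blast
    qed
  qed
  moreover have "card (\<Union>\<alpha>\<in>?I. C \<alpha>) = (\<Sum>\<alpha>\<in>?I. card (C \<alpha>))"
    by (rule card_UN_disjoint) (use finite_X_series_support[OF assms] fin disj in blast)+
  ultimately show ?thesis
    by (simp add: Y_series_def X)
qed

text \<open>Transpose the incidence relation between vertices and colours: properness says that
  every colour class is independent, and the content prescribes the class sizes, so the classes are
  chosen separately for each colour.\<close>

lemma (in graph) card_colorings_of_content:
  assumes "0 \<notin># m"
  shows "card (colorings_of_content G m) = (\<Prod>x\<in>set_mset m. independent_count G (count m x))"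
proof -
  let ?F = "PiE (set_mset m) (\<lambda>i. {S \<in> independent_sets G. card S = count m i})"
  have "bij_betw (\<lambda>\<kappa>. \<lambda>i\<in>set_mset m. {v \<in> verts G. i \<in> \<kappa> v}) (colorings_of_content G m) ?F"
  proof (rule bij_betwI[where g = "\<lambda>S. \<lambda>v\<in>verts G. {i \<in> set_mset m. v \<in> S i}"])
    show "(\<lambda>\<kappa>. \<lambda>i\<in>set_mset m. {v \<in> verts G. i \<in> \<kappa> v}) \<in> colorings_of_content G m \<rightarrow> ?F"
    proof
      fix \<kappa> assume \<kappa>: "\<kappa> \<in> colorings_of_content G m"
      have "{v \<in> verts G. i \<in> \<kappa> v} \<in> independent_sets G" for i
        using \<kappa> by (fastforce simp: colorings_of_content_def independent_sets_def)
      then show "(\<lambda>i\<in>set_mset m. {v \<in> verts G. i \<in> \<kappa> v}) \<in> ?F"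
        using \<kappa> by (auto simp: colorings_of_content_def)
    qed
    show "(\<lambda>S. \<lambda>v\<in>verts G. {i \<in> set_mset m. v \<in> S i}) \<in> ?F \<rightarrow> colorings_of_content G m"
    proof
      fix S assume S: "S \<in> ?F"
      let ?\<kappa> = "\<lambda>v\<in>verts G. {i \<in> set_mset m. v \<in> S i}"
      have ind: "S i \<in> independent_sets G" "card (S i) = count m i" if "i \<in># m" for i
        using S that by (auto simp: PiE_iff)
      have "?\<kappa> v \<subseteq> {1..}" if "v \<in> verts G" for v
        using that assms by (auto simp: Suc_le_eq intro: gr0I)
      then have "?\<kappa> \<in> verts G \<rightarrow>\<^sub>E {S. finite S \<and> S \<subseteq> {1..}}"
        by auto
      moreover have "?\<kappa> u \<inter> ?\<kappa> v = {}" if "u \<rightarrow>\<^bsub>G\<^esub> v" for u v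
        using ind(1) that adj_in_verts[OF that] by (auto simp: independent_sets_def)
      moreover have "count m i = card {v \<in> verts G. i \<in> ?\<kappa> v}" for i
      proof (cases "i \<in># m")
        case True
        have "{v \<in> verts G. i \<in> ?\<kappa> v} = S i"
          using ind(1)[OF True] True by (auto simp: independent_sets_def)
        then show ?thesis using ind(2)[OF True] by simp
      next
        case False
        then have none: "{v \<in> verts G. i \<in> ?\<kappa> v} = {}"
          by auto
        show ?thesis
          unfolding none using False by (simp add: count_eq_zero_iff)
      qed
      ultimately show "?\<kappa> \<in> colorings_of_content G m"
        by (simp only: colorings_of_content_def mem_Collect_eq) blast
    qed
    fix \<kappa> assume \<kappa>: "\<kappa> \<in> colorings_of_content G m"
    \<comment> \<open>Colours outside \<open>m\<close> have empty classes, so the restriction to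
      \<open>set_mset m\<close> loses nothing.\<close>
    have sub: "\<kappa> v \<subseteq> set_mset m" if "v \<in> verts G" for v
    proof (rule multicolor_subset[OF finite_verts _ that])
      show "\<forall>i. count m i = card {v \<in> verts G. i \<in> \<kappa> v}"
        using \<kappa> unfolding colorings_of_content_def by blast
    qed
    have ext: "\<kappa> \<in> extensional (verts G)"
      using \<kappa> by (simp add: colorings_of_content_def PiE_iff)
    show "(\<lambda>v\<in>verts G. {i \<in> set_mset m. v \<in> (\<lambda>i\<in>set_mset m. {v \<in> verts G. i \<in> \<kappa> v}) i}) = \<kappa>"
      by (rule extensionalityI[OF _ ext]) (use sub in auto)
  next
    fix S assume S: "S \<in> ?F"
    then have ext: "S \<in> extensional (set_mset m)"
      by (simp add: PiE_iff)
    show "(\<lambda>i\<in>set_mset m. {v \<in> verts G. i \<in> (\<lambda>v\<in>verts G. {i \<in> set_mset m. v \<in> S i}) v}) = S"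
      by (rule extensionalityI[OF _ ext]) (use S in \<open>auto simp: PiE_iff independent_sets_def\<close>)
  qed
  then show ?thesis
    by (simp add: bij_betw_same_card card_PiE independent_count_def)
qed

lemma (in graph) Y_series_eq_prod:
  "Y_series G m = (if 0 \<in># m then 0 else \<Prod>x\<in>set_mset m. int (independent_count G (count m x)))"
proof (cases "0 \<in># m")
  case True
  have "colorings_of_content G m = {}"
  proof (rule ccontr)
    assume "\<not> ?thesis"
    then obtain \<kappa> where \<kappa>: "\<kappa> \<in> colorings_of_content G m"
      by blast
    then have "count m 0 = card {v \<in> verts G. 0 \<in> \<kappa> v}"
      by (simp add: colorings_of_content_def)
    moreover have "{v \<in> verts G. 0 \<in> \<kappa> v} = {}"
      using \<kappa> by (force simp: colorings_of_content_def PiE_iff)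
    ultimately have "count m 0 = 0"
      by (simp only: card.empty)
    then show False
      using True by (simp add: count_eq_zero_iff)
  qed
  then show ?thesis
    using True Y_series_eq_card[OF finite_verts, of m] by simp
qed (simp add: Y_series_eq_card card_colorings_of_content)

lemma (in graph) symmetric_Y_series: "symmetric (Y_series G)"
  unfolding Y_series_eq_prod[abs_def]
  by (rule symmetric_content_prod)

lemma (in graph) Y_series_two_variable:
  "Y_series G (two_variable p q) = int (independent_count G p) * int (independent_count G q)"
proof -
  let ?h = "\<lambda>x. int (independent_count G (count (two_variable p q) x))"
  \<comment> \<open>A variable with exponent 0 is absent from the support, but its factor would be
    \<open>independent_count G 0 = 1\<close>.\<close>
  have "(\<Prod>x\<in>set_mset (two_variable p q). ?h x) = (\<Prod>x\<in>{1, 2}. ?h x)"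
    by (rule prod.mono_neutral_left)
      (auto simp: two_variable_def independent_count_0 split: if_splits)
  moreover have "0 \<notin># two_variable p q"
    by (auto simp: two_variable_def)
  ultimately show ?thesis
    by (simp add: Y_series_eq_prod) (simp add: two_variable_def)
qed

text \<open>The two-row Jacobi-Trudi determinant in the independence counts; the case distinction
  reads the count at index -1 as 0.\<close>

lemma (in graph) schur_coeff_Y_series:
  assumes "is_partition \<mu>" "length \<mu> \<le> 2"
  shows "schur_coeff \<mu> (Y_series G) =
    int (independent_count G (row \<mu> 0)) * int (independent_count G (row \<mu> 1)) -
    (if row \<mu> 1 = 0 then 0
     else int (independent_count G (Suc (row \<mu> 0))) * int (independent_count G (row \<mu> 1 - 1)))"
  by (simp add: schur_coeff_two_rows[OF symmetric_Y_series assms] Y_series_two_variable)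

section \<open>Coefficients and degree of the independence polynomial\<close>

lemma (in graph) independent_count_pos_iff:
  "0 < independent_count G j \<longleftrightarrow> j \<le> independence_number G"
proof
  assume "0 < independent_count G j"
  then obtain S where "S \<in> independent_sets G" "card S = j"
    by (auto simp: independent_count_def card_gt_0_iff)
  then show "j \<le> independence_number G"
    unfolding independence_number_def using finite_independent_sets by (metis Max_ge finite_imageI image_eqI)
next
  assume j: "j \<le> independence_number G"
  have "{} \<in> independent_sets G"
    by (simp add: independent_sets_def)
  then have "independence_number G \<in> card ` independent_sets G"
    unfolding independence_number_def using finite_independent_sets by (intro Max_in) auto
  then obtain S where S: "S \<in> independent_sets G" "card S = independence_number G"
    by auto
  \<comment> \<open>Subsets of independent sets are independent, so every size up to the maximum
    occurs; this excludes internal zeros.\<close>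
  then obtain T where T: "T \<subseteq> S" "card T = j"
    using j obtain_subset_with_card_n by metis
  then have "T \<in> {S \<in> independent_sets G. card S = j}"
    using S(1) by (auto simp: independent_sets_def)
  then show "0 < independent_count G j"
    unfolding independent_count_def card_gt_0_iff using finite_independent_sets by auto
qed

lemma (in graph) independent_count_eq_0: "independence_number G < j \<Longrightarrow> independent_count G j = 0"
  using independent_count_pos_iff[of j] by simp

lemma (in graph) coeff_independence_poly:
  "coeff (independence_poly G) j = int (independent_count G j)"
proof -
  have "coeff (independence_poly G) j = (if j \<le> independence_number G then int (independent_count G j) else 0)"
    by (simp add: independence_poly_def coeff_sum sum.delta flip: independent_count_def)
  then show ?thesis
    by (simp add: independent_count_eq_0)
qed

lemma (in graph) degree_independence_poly: "degree (independence_poly G) = independence_number G"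
proof (rule antisym)
  show "degree (independence_poly G) \<le> independence_number G"
    by (rule degree_le) (simp add: coeff_independence_poly independent_count_eq_0)
  show "independence_number G \<le> degree (independence_poly G)"
    by (rule le_degree) (use independent_count_pos_iff in \<open>auto simp: coeff_independence_poly\<close>)
qed

section \<open>Log-concavity\<close>

text \<open>Log-concavity of a positive sequence means that the quotients of consecutive terms
  decrease. All comparisons are cross-multiplied to remain in the integers.\<close>

lemma log_concave_imp_strongly_log_concave:
  assumes "log_concave p" and pos: "\<And>j. j \<le> degree p \<Longrightarrow> coeff p j > 0"
  shows "strongly_log_concave p"
proof -
  define c where "c = coeff p"
  let ?d = "degree p"
  have local_log_concave: "c (Suc j) * c (Suc j) \<ge> c j * c (Suc (Suc j))" if "Suc (Suc j) \<le> ?d" for j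
    using assms(1)[unfolded log_concave_def, rule_format, of "Suc j"] that
    by (simp add: c_def power2_eq_square)
  \<comment> \<open>The quotient at \<open>k\<close> is at least the quotient at any later
    \<open>n\<close>.\<close>
  have adj: "c (Suc k) * c n \<ge> c k * c (Suc n)" if "k \<le> n" "Suc n \<le> ?d" for k n
    using that
  proof (induction n rule: dec_induct)
    case base
    then show ?case by simp
  next
    case (step n)
    have "(c k * c (Suc n)) * c (Suc (Suc n)) \<le> (c (Suc k) * c n) * c (Suc (Suc n))"
      using step pos[of "Suc (Suc n)"] by (intro mult_right_mono) (auto simp: c_def)
    also have "\<dots> = c (Suc k) * (c n * c (Suc (Suc n)))"
      by simp
    also have "\<dots> \<le> c (Suc k) * (c (Suc n) * c (Suc n))"
      using step pos[of "Suc k"] local_log_concave[of n]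
      by (intro mult_left_mono) (auto simp: c_def)
    \<comment> \<open>The chain compares both sides only up to the positive factor
      \<open>c (Suc n)\<close>, which is then cancelled.\<close>
    finally have "(c k * c (Suc (Suc n))) * c (Suc n) \<le> (c (Suc k) * c (Suc n)) * c (Suc n)"
      by (simp add: mult_ac)
    then show ?case
      using pos[of "Suc n"] step.prems by (simp add: c_def)
  qed
  \<comment> \<open>The outer pair of indices moves inward one step at a time, each step being an
    instance of \<open>adj\<close>.\<close>
  have shift: "c k * c (m + r) \<le> c (k + r) * c m" if "k + r \<le> m" "m + r \<le> ?d" for k m r
    using that
  proof (induction r arbitrary: k)
    case (Suc r)
    have "c k * c (m + Suc r) \<le> c (Suc k) * c (m + r)"
      using adj[of k "m + r"] Suc.prems by simp
    also have "\<dots> \<le> c (Suc k + r) * c m"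
      using Suc.IH[of "Suc k"] Suc.prems by simp
    finally show ?case by simp
  qed simp
  show ?thesis
    unfolding strongly_log_concave_def
  proof (intro allI impI)
    fix k m n q assume a: "k < m \<and> m \<le> n \<and> n < q \<and> q \<le> ?d \<and> m + n = k + q"
    \<comment> \<open>Equal index sums make both gaps equal, so \<open>shift\<close> applies with
      step count \<open>m - k\<close>.\<close>
    then have "n + (m - k) = q"
      by arith
    then show "coeff p k * coeff p q \<le> coeff p m * coeff p n"
      using shift[of k "m - k" n] a by (simp add: c_def)
  qed
qed

theorem corollary2p2:
  fixes G :: "('a, 'b) pre_digraph"
  assumes "graph G"
  shows "((\<forall>\<mu>. is_partition \<mu> \<and> length \<mu> \<le> 2 \<longrightarrow> schur_coeff \<mu> (Y_series G) \<ge> 0) \<longleftrightarrow>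
          (\<forall>k \<ge> 1. schur_coeff [k, k] (Y_series G) \<ge> 0)) \<and>
         ((\<forall>k \<ge> 1. schur_coeff [k, k] (Y_series G) \<ge> 0) \<longleftrightarrow>
          log_concave (independence_poly G)) \<and>
         (log_concave (independence_poly G) \<longleftrightarrow>
          strongly_log_concave (independence_poly G))"
proof -
  interpret graph G by (rule assms)
  let ?I = "independence_poly G" and ?h = "\<lambda>j. int (independent_count G j)"
  let ?S1 = "\<forall>\<mu>. is_partition \<mu> \<and> length \<mu> \<le> 2 \<longrightarrow> schur_coeff \<mu> (Y_series G) \<ge> 0"
  let ?S2 = "\<forall>k \<ge> 1. schur_coeff [k, k] (Y_series G) \<ge> 0"
  \<comment> \<open>The implications are proved as a cycle (1), (2), (3), (4), (1).\<close>
  have S1_S2: ?S2 if ?S1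
    using that by (simp add: is_partition_def)
  have S2_log_concave: "log_concave ?I" if ?S2
    unfolding log_concave_def
  proof (intro allI impI)
    fix j assume j: "1 \<le> j \<and> j \<le> degree ?I - 1"
    then have "schur_coeff [j, j] (Y_series G) \<ge> 0"
      using that by blast
    then show "coeff ?I (j - 1) * coeff ?I (j + 1) \<le> (coeff ?I j)\<^sup>2"
      using schur_coeff_Y_series[of "[j, j]"] j
      by (simp add: is_partition_def row_def coeff_independence_poly power2_eq_square mult.commute)
  qed
  have log_concave_strongly: "strongly_log_concave ?I" if "log_concave ?I"
    by (rule log_concave_imp_strongly_log_concave[OF that])
      (simp add: coeff_independence_poly degree_independence_poly independent_count_pos_iff)
  have strongly_S1: ?S1 if "strongly_log_concave ?I"
  proof (intro allI impI)
    fix \<mu> assume \<mu>: "is_partition \<mu> \<and> length \<mu> \<le> 2"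
    let ?p = "row \<mu> 0" and ?q = "row \<mu> 1"
    have "?q \<le> ?p"
      using \<mu> by (intro row_antimono) auto
    have "?h (Suc ?p) * ?h (?q - 1) \<le> ?h ?p * ?h ?q" if "?q \<noteq> 0"
    \<comment> \<open>Strong log-concavity speaks only of indices up to the degree; beyond it the
      left-hand product is 0.\<close>
    proof (cases "Suc ?p \<le> independence_number G")
      case True
      then show ?thesis
        using \<open>strongly_log_concave ?I\<close>[unfolded strongly_log_concave_def, rule_format,
            of "?q - 1" ?q ?p "Suc ?p"] that \<open>?q \<le> ?p\<close>
        by (simp add: coeff_independence_poly degree_independence_poly mult.commute)
    next
      case False
      then show ?thesis by (simp add: independent_count_eq_0)
    qed
    then show "schur_coeff \<mu> (Y_series G) \<ge> 0"
      using schur_coeff_Y_series \<mu> by simp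
  qed
  show ?thesis
    using S1_S2 S2_log_concave log_concave_strongly strongly_S1 by blast
qed

end
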